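(* Let $d\geqslant 2$ and let $\mu$ be a Borel probability measure on $\mathbb G=GL(d,\mathbb R)$ satisfying conditions (A1) and (A2) below, and let $\nu$ be the unique $\mu$-stationary probability measure on $\mathbb P^{d-1}$. Then for every algebraic subset $Y$ of $\mathbb P^{d-1}$, either $\nu(Y)=0$ or $\nu(Y)=1$.
   Context: $\mathbb P^{d-1}$ is the real projective space of $\mathbb R^d$; $g\in\mathbb G$ acts on it by $g(\mathbb Rv)=\mathbb R(gv)$. $\Gamma_\mu$ denotes the smallest closed subsemigroup of $\mathbb G$ containing the support of $\mu$. (A1) Strong irreducibility: no finite union of proper linear subspaces of $\mathbb R^d$ is invariant under every $g\in\Gamma_\mu$. (A2) Proximality: $\Gamma_\mu$ contains a proximal matrix, i.e. a matrix having an algebraically simple eigenvalue $\lambda_g$ with $|\lambda_g|>|\lambda'|$ for every other eigenvalue $\lambda'$. Under (A1),(A2) there is a unique probability measure $\nu$ on $\mathbb P^{d-1}$ with $\int\int \varphi(gx)\,\mu(dg)\,\nu(dx)=\int\varphi\,d\nu$ for all continuous $\varphi$ (the $\mu$-stationary measure). A subset $X\subset\mathbb R^d$ is algebraic if it is the common zero set of finitely many real polynomials, and homogeneous if $tv\in X$ for all $t\in\mathbb R$, $v\in X$; a subset $Y\subset \mathbb P^{d-1}$ is algebraic if it is the projective image of a homogeneous algebraic subset of $\mathbb R^d$. *)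

theory Defs
  imports "HOL-Probability.Probability" "HOL-Computational_Algebra.Polynomial"
begin

text \<open>Points of the real projective space P^(d-1) are the lines (one-dimensional
  linear subspaces) of R^d, with R^d rendered as real^'n, d = CARD('n).\<close>

definition pline :: "real^'n \<Rightarrow> (real^'n) set" where
  "pline v = span {v}"

definition Pspace :: "(real^'n) set set" where
  "Pspace = {pline v | v. v \<noteq> 0}"

definition popen :: "(real^'n) set set \<Rightarrow> bool" where
  "popen U \<longleftrightarrow> U \<subseteq> Pspace \<and> open {v. v \<noteq> 0 \<and> pline v \<in> U}"

lemma istopology_popen: "istopology (popen :: (real^'n) set set \<Rightarrow> bool)"
proof -
  have 1: "{v. v \<noteq> 0 \<and> pline v \<in> S \<inter> T} =
     {v. v \<noteq> 0 \<and> pline v \<in> S} \<inter> {v. v \<noteq> 0 \<and> pline v \<in> T}" for S T :: "(real^'n) set set"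
    by auto
  have 2: "{v. v \<noteq> 0 \<and> pline v \<in> \<Union>K} = (\<Union>U\<in>K. {v. v \<noteq> 0 \<and> pline v \<in> U})"
    for K :: "(real^'n) set set set"
    by auto
  show ?thesis
    unfolding istopology_def popen_def 1 2
    by (auto intro!: open_Int open_UN)
qed

definition ptop :: "(real^'n) set topology" where
  "ptop = topology popen"

definition pborel :: "(real^'n) set measure" where
  "pborel = sigma (topspace ptop) {U. openin ptop U}"

definition pact :: "real^'n^'n \<Rightarrow> (real^'n) set \<Rightarrow> (real^'n) set" where
  "pact g L = (\<lambda>v. g *v v) ` L"

definition GL :: "(real^'n^'n) set" where
  "GL = {g. invertible g}"

definition msupport :: "(real^'n^'n) measure \<Rightarrow> (real^'n^'n) set" where
  "msupport \<mu> = {g \<in> GL. \<forall>U. open U \<longrightarrow> g \<in> U \<longrightarrow> measure \<mu> (U \<inter> GL) > 0}"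

definition Gamma_mu :: "(real^'n^'n) measure \<Rightarrow> (real^'n^'n) set" where
  "Gamma_mu \<mu> = \<Inter>{S. msupport \<mu> \<subseteq> S \<and> S \<subseteq> GL \<and> closedin (top_of_set GL) S
                  \<and> (\<forall>a\<in>S. \<forall>b\<in>S. a ** b \<in> S)}"

text \<open>(A1) strong irreducibility (proper subspaces are taken nonzero).\<close>
definition strongly_irreducible :: "(real^'n^'n) set \<Rightarrow> bool" where
  "strongly_irreducible G \<longleftrightarrow>
     (\<forall>F. finite F \<and> F \<noteq> {} \<and> (\<forall>W\<in>F. subspace W \<and> W \<noteq> {0} \<and> W \<noteq> UNIV)
        \<longrightarrow> \<not> (\<forall>g\<in>G. (\<lambda>v. g *v v) ` (\<Union>F) \<subseteq> \<Union>F))"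

definition charpoly :: "real^'n^'n \<Rightarrow> complex poly" where
  "charpoly A = det (\<chi> i j. (if i = j then [:0, 1:] else 0) - [:complex_of_real (A $ i $ j):])"

definition proximal :: "real^'n^'n \<Rightarrow> bool" where
  "proximal g \<longleftrightarrow> (\<exists>c. poly (charpoly g) c = 0 \<and> order c (charpoly g) = 1 \<and>
     (\<forall>\<kappa>. poly (charpoly g) \<kappa> = 0 \<and> \<kappa> \<noteq> c \<longrightarrow> cmod \<kappa> < cmod c))"

inductive_set polyfun :: "(real^'n \<Rightarrow> real) set" where
  pf_const: "(\<lambda>v. c) \<in> polyfun"
| pf_coord: "(\<lambda>v. v $ i) \<in> polyfun"
| pf_add: "p \<in> polyfun \<Longrightarrow> q \<in> polyfun \<Longrightarrow> (\<lambda>v. p v + q v) \<in> polyfun"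
| pf_mult: "p \<in> polyfun \<Longrightarrow> q \<in> polyfun \<Longrightarrow> (\<lambda>v. p v * q v) \<in> polyfun"

definition algebraic_set :: "(real^'n) set \<Rightarrow> bool" where
  "algebraic_set X \<longleftrightarrow> (\<exists>P. finite P \<and> P \<subseteq> polyfun \<and> X = {v. \<forall>p\<in>P. p v = 0})"

definition homogeneous_set :: "(real^'n) set \<Rightarrow> bool" where
  "homogeneous_set X \<longleftrightarrow> (\<forall>t v. v \<in> X \<longrightarrow> t *\<^sub>R v \<in> X)"

definition palgebraic :: "(real^'n) set set \<Rightarrow> bool" where
  "palgebraic Y \<longleftrightarrow> (\<exists>X. algebraic_set X \<and> homogeneous_set X \<and>
                        Y = {pline v | v. v \<in> X \<and> v \<noteq> 0})"

definition stationary :: "(real^'n^'n) measure \<Rightarrow> (real^'n) set measure \<Rightarrow> bool" where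
  "stationary \<mu> \<nu> \<longleftrightarrow> prob_space \<nu> \<and> sets \<nu> = sets pborel \<and>
     (\<forall>\<phi>. continuous_map ptop euclideanreal \<phi> \<longrightarrow>
        (\<integral>x. (\<integral>g. \<phi> (pact g x) \<partial>\<mu>) \<partial>\<nu>) = (\<integral>x. \<phi> x \<partial>\<nu>))"

end

theory Submission
  imports Defs "HOL-Complex_Analysis.Complex_Analysis" "HOL-Library.Function_Algebras"
begin

text \<open>
  Lift \<open>\<nu>\<close> to a measure \<open>\<rho>\<close> on nonzero vectors, and let \<open>V\<close> be a finite-dimensional, \<open>GL\<close>-invariant
  space of polynomials containing the equations of \<open>Y\<close>. Among the cones cut out by elements of \<open>V\<close>
  that have positive mass, take those of minimal rank (codimension of the space of equations in \<open>V\<close>)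
  and, among these, those of maximal mass. Distinct cones of minimal rank meet in a null set, so there
  are finitely many of maximal mass; by stationarity \<open>\<Gamma>\<close> permutes them, and by strong
  irreducibility each of them spans the whole space. In particular (linear forms) proper subspaces
  are null. A power of a proximal element fixes each of these cones, so all contain its attracting line
  and their intersection \<open>N\<close> is a nonempty invariant closed cone.

  Furstenberg's contraction argument gives \<open>\<rho>(N) = 1\<close>. The averages \<open>M(b)\<close> of the projections onto the lines
  \<open>\<real>bv\<close> form a bounded martingale along random products \<open>b = g\<^sub>1\<dots>g\<^sub>n\<close>, so a limit \<open>A\<close> of typical
  normalised products satisfies \<open>M(Ag) = M(A)\<close> for all \<open>g \<in> \<Gamma>\<close>. Letting \<open>g\<close> run through powers of
  a proximal element shows that \<open>M(A)\<close> is a rank one projection, hence \<open>A\<close> has rank one, and its image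
  lies in \<open>N\<close>. Therefore a cone of minimal rank and maximal mass has full measure, and it is either contained in
  \<open>Y\<close> or meets \<open>Y\<close> in a null set.
\<close>

section \<open>Powers of a proximal matrix\<close>

text \<open>The codimension of the space of equations replaces algebraic dimension. It is a natural
  number, strictly monotone on cones cut out in a fixed degree and unchanged by invertible
  substitutions, so a cone of minimal rank meets any member of the family in itself or in a null
  set, without irreducible components. The limit \<open>A\<close> of normalised products is usually
  singular. The average \<open>M\<close> is continuous at a singular matrix only if its kernel is
  null; hence the minimal cone argument is run once for linear subspaces before any contraction
  takes place. No space of infinite trajectories is built. The mean of the squared norm of
  \<open>M(b)\<close> is bounded and increases with the number of factors, so after many factors the
  mean square change of \<open>M\<close> under k more is small, and one good product can be picked
  at each stage. To compare \<open>A\<close> with \<open>N\<close>, \<open>A\<close> must not vanish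
  on \<open>N\<close>, so \<open>N\<close> has to span. The attracting line supplies one nonzero
  vector of \<open>N\<close>, and irreducibility does the rest.\<close>

definition cmat :: "real^'n^'n \<Rightarrow> complex^'n^'n" where
  "cmat A = (\<chi> i j. complex_of_real (A $ i $ j))"

lemma poly_charpoly: "poly (charpoly A) z = det (mat z - cmat A)"
proof -
  have "poly (charpoly A) z = (\<Sum>p | p permutes (UNIV::'a set). of_int (sign p) *
      (\<Prod>i\<in>UNIV. poly ((if i = p i then [:0, 1:] else 0) - [:complex_of_real (A $ i $ p i):]) z))"
    unfolding charpoly_def det_def by (simp add: poly_sum poly_prod)
  also have "\<dots> = det (mat z - cmat A)"
    unfolding det_def
    by (intro sum.cong refl arg_cong2[where f="(*)"] prod.cong) (auto simp: mat_def cmat_def)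
  finally show ?thesis .
qed

lemma matrix_mult_diag_right:
  fixes A :: "'a::semiring_1^'n^'m"
  shows "A ** (\<chi> i j. if i = j then d j else 0) = (\<chi> i j. A $ i $ j * d j)"
proof -
  have "(\<Sum>k\<in>UNIV. A $ i $ k * (if k = j then d j else 0)) = A $ i $ j * d j" for i j
    by (subst sum.remove[of _ j]) auto
  then show ?thesis by (simp add: matrix_matrix_mult_def)
qed

text \<open>The reversed characteristic polynomial det(1 - tA) is the common denominator of the
  generating series of the powers of A, which are studied near t = 0; its zeros are the reciprocals
  of the nonzero eigenvalues.\<close>

lemma charpoly_reciprocal:
  fixes A :: "real^'n^'n"
  assumes "t \<noteq> 0"
  shows "det (mat 1 - (\<chi> i j. t * cmat A $ i $ j)) = t ^ CARD('n) * poly (charpoly A) (1/t)"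
proof -
  have "(\<chi> i j. if i = j then (\<lambda>_. t) j else 0) = (mat t :: complex^'n^'n)" by (simp add: mat_def)
  then have "mat 1 - (\<chi> i j. t * cmat A $ i $ j) =
      (mat (1/t) - cmat A) ** (\<chi> i j. if i = j then (\<lambda>_. t) j else 0)"
    unfolding matrix_mult_diag_right using assms by (auto simp: vec_eq_iff mat_def algebra_simps)
  then show ?thesis by (simp add: det_mul det_diagonal poly_charpoly)
qed

lemma continuous_on_det_entries:
  fixes M :: "'b::topological_space \<Rightarrow> 'a::real_normed_field^'n^'n"
  assumes "\<And>i j. continuous_on S (\<lambda>z. M z $ i $ j)"
  shows "continuous_on S (\<lambda>z. det (M z))"
  unfolding det_def by (intro continuous_intros assms)

text \<open>The order of a root is informative only for a nonzero polynomial. If this one were 0,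
  det(1 - tA) would vanish for all nonzero t, yet it is continuous in t with value 1 at 0.\<close>

lemma charpoly_nonzero: "charpoly (A :: real^'n^'n) \<noteq> 0"
proof
  assume 0: "charpoly A = 0"
  define D where "D t = det (mat 1 - (\<chi> i j. t * cmat A $ i $ j))" for t
  have "continuous_on UNIV D"
    unfolding D_def by (rule continuous_on_det_entries) (simp, intro continuous_intros)
  then have "D \<midarrow>0\<rightarrow> D 0" by (simp add: continuous_on_eq_continuous_at isCont_def)
  moreover have "eventually (\<lambda>t. D t = 0) (at 0)"
    by (auto simp: eventually_at_filter D_def charpoly_reciprocal 0)
  then have "D \<midarrow>0\<rightarrow> 0" by (rule tendsto_eventually)
  ultimately have "D 0 = 0" by (rule LIM_unique)
  moreover have "mat 1 - (\<chi> i j. 0 * cmat A $ i $ j) = mat 1" by (simp add: vec_eq_iff)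
  ultimately show False by (simp add: D_def)
qed

text \<open>If two eigenvectors were independent, Cramer's rule in two columns would pull the factor
  (z - c)^2 out of a nonzero multiple of the characteristic polynomial, against simplicity of the
  root.\<close>

lemma simple_eigenvalue_eigenspace:
  fixes A :: "real^'n^'n" and c :: complex
  assumes ord: "order c (charpoly A) = 1"
    and u: "cmat A *v u = c *s u" "u \<noteq> 0" and w: "cmat A *v w = c *s w"
  shows "\<exists>t. w = t *s u"
proof -
  obtain a where a: "u $ a \<noteq> 0" using u(2) by (auto simp: vec_eq_iff)
  \<comment> \<open>Clearing coordinate \<open>a\<close> separates the two column replacements: the
    index \<open>b\<close> found for \<open>w'\<close> differs from \<open>a\<close>, and replacing
    column \<open>a\<close> does not change the product with \<open>w'\<close>.\<close>
  define w' where "w' = w - (w $ a / u $ a) *s u"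
  have w'a: "w' $ a = 0" using a by (simp add: w'_def)
  have w': "cmat A *v w' = c *s w'"
    unfolding w'_def by (simp add: matrix_vector_mult_diff_distrib vector_scalar_commute u w
        vector_ssub_ldistrib mult.commute vector_smult_assoc)
  have "w' = 0"
  proof (rule ccontr)
    assume "w' \<noteq> 0"
    then obtain b where b: "w' $ b \<noteq> 0" by (auto simp: vec_eq_iff)
    have ab: "a \<noteq> b" using w'a b by auto
    define C where "C z = (\<chi> i j. if j = a then u $ i else if j = b then w' $ i
        else (mat z - cmat A) $ i $ j)" for z
    have key: "w' $ b * (u $ a * poly (charpoly A) z) = (z - c)^2 * det (C z)" for z
    proof -
      define B where "B = mat z - cmat A"
      define B1 where "B1 = (\<chi> i j. if j = a then (B *v u) $ i else B $ i $ j)"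
      have d1: "det B1 = u $ a * det B" unfolding B1_def by (rule cramer_lemma)
      have matz: "mat z *v x = z *s x" for x :: "complex^'n"
        by (simp add: vec_eq_iff matrix_vector_mult_def mat_def if_distrib if_distribR cong: if_cong)
      have Bu: "B *v u = (z - c) *s u" and Bw: "B *v w' = (z - c) *s w'"
        by (simp_all add: B_def matrix_vector_mult_diff_rdistrib u w' matz vector_sub_rdistrib)
      have "(B1 *v w') = B *v w'"
        unfolding B1_def matrix_vector_mult_def vec_eq_iff using w'a
        by (auto intro!: sum.cong)
      then have d2: "det (\<chi> i j. if j = b then (B *v w') $ i else B1 $ i $ j) = w' $ b * det B1"
        using cramer_lemma[of b B1 w'] by (simp only:)
      define d where "d j = (if j = a \<or> j = b then z - c else 1)" for j
      have "(\<chi> i j. if j = b then (B *v w') $ i else B1 $ i $ j) = C z ** (\<chi> i j. if i = j then d j else 0)"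
        unfolding matrix_mult_diag_right Bw B1_def Bu C_def d_def B_def[symmetric] vec_eq_iff using ab
        by (simp add: algebra_simps)
      then have "det (\<chi> i j. if j = b then (B *v w') $ i else B1 $ i $ j) = det (C z) * (\<Prod>j\<in>UNIV. d j)"
        by (simp add: det_mul det_diagonal)
      also have "(\<Prod>j\<in>UNIV. d j) = (\<Prod>j\<in>{a,b}. d j)"
        by (rule prod.mono_neutral_right) (auto simp: d_def)
      also have "\<dots> = (z - c)^2" using ab by (simp add: d_def power2_eq_square)
      finally show ?thesis using d1 d2 by (simp add: poly_charpoly B_def)
    qed
    have p0: "charpoly A \<noteq> 0" by (rule charpoly_nonzero)
    obtain q where q: "charpoly A = [:-c, 1:] * q" "poly q c \<noteq> 0"
      using order_decomp[OF p0, of c] ord by (auto simp: poly_eq_0_iff_dvd)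
    \<comment> \<open>Both sides of \<open>key\<close> vanish at z = c, so a factor is cancelled
      away from c and the value at c is recovered by continuity.\<close>
    have eq: "w' $ b * (u $ a * poly q z) = (z - c) * det (C z)" if "z \<noteq> c" for z
    proof -
      have "(z - c) * (w' $ b * (u $ a * poly q z)) = (z - c) * ((z - c) * det (C z))"
        using key[of z] by (simp add: q(1) power2_eq_square algebra_simps)
      then show ?thesis using that by simp
    qed
    have "continuous_on UNIV (\<lambda>z. det (C z))"
    proof (rule continuous_on_det_entries)
      show "continuous_on UNIV (\<lambda>z. C z $ i $ j)" for i j
        by (cases "j = a"; cases "j = b"; cases "i = j") (auto simp: C_def mat_def intro!: continuous_intros)
    qed
    then have "isCont (\<lambda>z. det (C z)) c" by (simp add: continuous_on_eq_continuous_at)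
    then have "((\<lambda>z. (z - c) * det (C z)) \<longlongrightarrow> (c - c) * det (C c)) (at c)"
      by (intro tendsto_intros) (auto simp: isCont_def)
    then have "((\<lambda>z. w' $ b * (u $ a * poly q z)) \<longlongrightarrow> (c - c) * det (C c)) (at c)"
      by (rule Lim_transform_eventually) (use eq in \<open>auto simp: eventually_at_filter\<close>)
    moreover have "((\<lambda>z. w' $ b * (u $ a * poly q z)) \<longlongrightarrow> w' $ b * (u $ a * poly q c)) (at c)"
      by (intro tendsto_intros)
    ultimately have "w' $ b * (u $ a * poly q c) = (c - c) * det (C c)"
      by (rule LIM_unique[THEN sym])
    then show False using a b q by simp
  qed
  then show ?thesis by (metis w'_def eq_iff_diff_eq_0)
qed

section \<open>Convergence of powers divided by the dominant eigenvalue\<close>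

primrec matpow :: "'a::semiring_1^'n^'n \<Rightarrow> nat \<Rightarrow> 'a^'n^'n" where
  "matpow A 0 = mat 1"
| "matpow A (Suc j) = A ** matpow A j"

text \<open>A crude growth bound that gives the generating series of the entries a positive radius
  of convergence. The added 1 keeps \<open>K\<close> positive for the zero matrix.\<close>

lemma matpow_entry_bound:
  fixes A :: "real^'n^'n"
  shows "\<exists>K>0. \<forall>j i k. \<bar>matpow A j $ i $ k\<bar> \<le> K ^ j"
proof -
  define K where "K = (\<Sum>i\<in>UNIV. \<Sum>k\<in>UNIV. \<bar>A $ i $ k\<bar>) + 1"
  have row: "(\<Sum>k\<in>UNIV. \<bar>A $ i $ k\<bar>) \<le> K" for i
    unfolding K_def using member_le_sum[of i UNIV "\<lambda>i. \<Sum>k\<in>UNIV. \<bar>A $ i $ k\<bar>"]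
    by (simp add: sum_nonneg)
  have "\<bar>matpow A j $ i $ k\<bar> \<le> K ^ j" for j i k
  proof (induction j arbitrary: i k)
    case 0 then show ?case by (simp add: mat_def)
  next
    case (Suc j)
    have "\<bar>matpow A (Suc j) $ i $ k\<bar> \<le> (\<Sum>l\<in>UNIV. \<bar>A $ i $ l * matpow A j $ l $ k\<bar>)"
      by (simp add: matrix_matrix_mult_def)
    also have "\<dots> \<le> (\<Sum>l\<in>UNIV. \<bar>A $ i $ l\<bar> * K ^ j)"
      by (intro sum_mono) (simp add: abs_mult mult_left_mono Suc)
    also have "\<dots> \<le> K * K ^ j"
      unfolding sum_distrib_right[symmetric]
      by (intro mult_right_mono row) (auto simp: K_def sum_nonneg)
    finally show ?case by simp
  qed
  moreover have "K > 0" unfolding K_def by (smt (verit) sum_nonneg abs_ge_zero)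
  ultimately show ?thesis by blast
qed

text \<open>By Cramer's rule \<open>(1 - c t) \<Sum>\<^sub>j (A\<^sup>j)\<^sub>i\<^sub>k t\<^sup>j\<close> is a quotient of polynomials without poles in a
  disc around 0 of radius larger than \<open>1 / |c|\<close>, and the partial sums of its power series at \<open>1 / c\<close> are
  the terms of the sequence.\<close>

lemma dominant_simple_root_convergence:
  fixes A :: "real^'n^'n" and c :: complex
  assumes root: "poly (charpoly A) c = 0" and ord: "order c (charpoly A) = 1"
    and dom: "\<And>\<kappa>. poly (charpoly A) \<kappa> = 0 \<Longrightarrow> \<kappa> \<noteq> c \<Longrightarrow> cmod \<kappa> < cmod c"
    and c0: "c \<noteq> 0"
  shows "convergent (\<lambda>j. complex_of_real (matpow A j $ i $ k) / c ^ j)"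
proof -
  define D where "D t = det (mat 1 - (\<chi> i j. t * cmat A $ i $ j))" for t
  define Num where "Num t = det (\<chi> r s. if s = i then (if r = k then 1 else 0)
     else (mat 1 - (\<chi> i j. t * cmat A $ i $ j)) $ r $ s)" for t
  have holD: "D holomorphic_on S" for S
    unfolding D_def det_def
    by (auto intro!: holomorphic_intros simp: if_distrib mat_def cong: if_cong)
  have holN: "Num holomorphic_on S" for S
  proof -
    have 1: "(\<lambda>t. (if s = i then (if r = k then 1 else 0)
       else (mat 1 - (\<chi> i j. t * cmat A $ i $ j)) $ r $ s)) holomorphic_on S" for r s
      by (cases "s = i"; cases "r = s") (auto intro!: holomorphic_intros simp: mat_def)
    show ?thesis unfolding Num_def det_def
      by (simp only: vec_lambda_beta) (intro holomorphic_intros 1)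
  qed
  have D0: "D 0 = 1" by (simp add: D_def vec_eq_iff zero_vec_def[symmetric] flip: vec_eq_iff)
  have Dp: "D t = t ^ CARD('n) * poly (charpoly A) (1/t)" if "t \<noteq> 0" for t
    unfolding D_def using that by (rule charpoly_reciprocal)
  have p0: "charpoly A \<noteq> 0" by (rule charpoly_nonzero)
  obtain q where q: "charpoly A = [:-c, 1:] * q" "poly q c \<noteq> 0"
    using order_decomp[OF p0, of c] ord by (auto simp: poly_eq_0_iff_dvd)
  \<comment> \<open>\<open>E\<close> is det(1 - tA) with the factor 1 - ct removed. The formula
    through \<open>q\<close> is meant for nonzero t; at 0 the value 1 = \<open>D 0\<close> is
    inserted.\<close>
  define E where "E t = (if t = 0 then 1 else t ^ (CARD('n) - 1) * poly q (1/t))" for t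
  have DE: "D t = (1 - c * t) * E t" for t
  proof (cases "t = 0")
    case False
    have "t ^ CARD('n) = t * t ^ (CARD('n) - 1)" by (metis power_eq_if card_eq_0_iff finite_UNIV UNIV_not_empty finite)
    then show ?thesis using False by (simp add: Dp q E_def field_simps)
  qed (simp add: E_def D0)
  have holE: "E holomorphic_on UNIV"
  proof -
    have 1: "E holomorphic_on -{0}"
    proof -
      have "(\<lambda>t. t ^ (CARD('n) - 1) * poly q (1/t)) holomorphic_on -{0}"
        by (intro holomorphic_intros) auto
      then show ?thesis by (rule holomorphic_transform) (auto simp: E_def)
    qed
    \<comment> \<open>Near 0 the quotient of \<open>D t\<close> by \<open>1 - c * t\<close> takes
      over, whose denominator has no zero inside radius 1/|c|.\<close>
    have 2: "E holomorphic_on ball 0 (1 / cmod c)"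
    proof -
      have nz: "1 - c * t \<noteq> 0" if "t \<in> ball 0 (1 / cmod c)" for t
      proof
        assume "1 - c * t = 0"
        then have "cmod c * cmod t = 1" by (metis eq_iff_diff_eq_0 norm_mult norm_one)
        then show False using that c0 by (simp add: field_simps)
      qed
      have "(\<lambda>t. D t / (1 - c * t)) holomorphic_on ball 0 (1 / cmod c)"
        using nz by (intro holomorphic_intros holD) auto
      then show ?thesis by (rule holomorphic_transform) (use nz in \<open>auto simp: DE\<close>)
    qed
    have "E holomorphic_on (-{0} \<union> ball 0 (1 / cmod c))"
      by (intro holomorphic_on_Un 1 2) auto
    moreover have "-{0} \<union> ball (0::complex) (1 / cmod c) = UNIV" using c0 by auto
    ultimately show ?thesis by simp
  qed
  \<comment> \<open>A zero of \<open>E\<close> is the reciprocal of a root of \<open>q\<close>, that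
    is, of an eigenvalue other than c; its modulus is below |c|, so the reciprocal lies outside the
    closed disc.\<close>
  have Enz: "E t \<noteq> 0" if "t \<in> cball 0 (1 / cmod c)" for t
  proof (cases "t = 0")
    case False
    have "poly q (1/t) \<noteq> 0"
    proof
      assume z: "poly q (1/t) = 0"
      then have "cmod (1/t) < cmod c" using q by (intro dom) auto
      then show False using that c0 False by (simp add: norm_divide field_simps)
    qed
    then show ?thesis using False by (simp add: E_def)
  qed (simp add: E_def)
  have "open {t. E t \<noteq> 0}"
  proof -
    have "continuous_on UNIV E" using holE holomorphic_on_imp_continuous_on by blast
    then have "open (E -` (-{0}))" by (intro continuous_open_vimage) (auto simp: continuous_on_eq_continuous_at)
    then show ?thesis by (simp add: vimage_def)
  qed
  moreover have "cball 0 (1 / cmod c) \<subseteq> {t. E t \<noteq> 0}" using Enz by auto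
  ultimately obtain \<epsilon> where e: "\<epsilon> > 0" "(\<Union>x\<in>cball 0 (1 / cmod c). ball x \<epsilon>) \<subseteq> {t. E t \<noteq> 0}"
    using compact_subset_open_imp_ball_epsilon_subset[of "cball 0 (1 / cmod c)"] by (metis compact_cball)
  define R where "R = 1 / cmod c + \<epsilon>"
  have ER: "E t \<noteq> 0" if "t \<in> ball 0 R" for t
  proof (cases "cmod t \<le> 1 / cmod c")
    case True then show ?thesis using Enz by simp
  next
    case False
    \<comment> \<open>\<open>s\<close> is the radial projection of \<open>t\<close> to the circle of
      radius 1/|c|, which shows that \<open>t\<close> is within \<open>\<epsilon>\<close> of the
      closed disc.\<close>
    define s where "s = complex_of_real (1 / cmod c / cmod t) * t"
    have t0: "cmod t > 0" using False c0 by (metis norm_ge_zero divide_nonneg_nonneg zero_le_one not_le order_trans less_le_trans)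
    have s: "cmod s = 1 / cmod c" using t0 by (simp add: s_def norm_mult norm_divide)
    have "dist s t = cmod t - 1 / cmod c"
    proof -
      have "s - t = complex_of_real (1 / cmod c / cmod t - 1) * t" by (simp add: s_def algebra_simps)
      then have "dist s t = \<bar>1 / cmod c / cmod t - 1\<bar> * cmod t" by (simp add: dist_norm norm_mult del: of_real_diff)
      moreover have "1 / cmod c / cmod t < 1" using False t0 by (subst pos_divide_less_eq) auto
      then have "\<bar>1 / cmod c / cmod t - 1\<bar> * cmod t = cmod t - 1 / cmod c"
        using t0 by (simp add: abs_if left_diff_distrib)
      ultimately show ?thesis by simp
    qed
    then have "t \<in> ball s \<epsilon>" using that by (simp add: R_def)
    then show ?thesis using e s by force
  qed
  define G where "G t = Num t / E t" for t
  have holG: "G holomorphic_on ball 0 R"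
    unfolding G_def using ER by (intro holomorphic_intros holN holomorphic_on_subset[OF holE]) auto
  obtain K where K: "K > 0" "\<And>j i k. \<bar>matpow A j $ i $ k\<bar> \<le> K ^ j"
    using matpow_entry_bound[of A] by blast
  define x where "x l t = (\<Sum>j. complex_of_real (matpow A j $ l $ k) * t ^ j)" for l t
  have summ: "summable (\<lambda>j. complex_of_real (matpow A j $ l $ k) * t ^ j)" if "cmod t < 1 / K" for l t
  proof (rule summable_comparison_test)
    have "cmod (complex_of_real (matpow A j $ l $ k) * t ^ j) \<le> (K * cmod t) ^ j" for j
      using K(2)[of j l k] by (simp add: norm_mult norm_power power_mult_distrib mult_right_mono)
    then show "\<exists>N. \<forall>n\<ge>N. cmod (complex_of_real (matpow A n $ l $ k) * t ^ n) \<le> (K * cmod t) ^ n" by blast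
    show "summable (\<lambda>j. (K * cmod t) ^ j)" using K(1) that by (intro summable_geometric) (simp add: field_simps)
  qed
  \<comment> \<open>Splitting off the term j = 0 shows that the vector of series solves (1 - tA) x =
    e_k.\<close>
  have xeq: "x l t = (if l = k then 1 else 0) + t * (\<Sum>r\<in>UNIV. cmat A $ l $ r * x r t)"
    if t: "cmod t < 1 / K" for l t
  proof -
    have "x l t = complex_of_real (matpow A 0 $ l $ k) +
        (\<Sum>j. complex_of_real (matpow A (Suc j) $ l $ k) * t ^ Suc j)"
      unfolding x_def using suminf_split_head[OF summ[OF t, of l]] by simp
    also have "(\<lambda>j. complex_of_real (matpow A (Suc j) $ l $ k) * t ^ Suc j) =
       (\<lambda>j. t * (\<Sum>r\<in>UNIV. cmat A $ l $ r * (complex_of_real (matpow A j $ r $ k) * t ^ j)))"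
      by (auto simp: matrix_matrix_mult_def cmat_def sum_distrib_left sum_distrib_right algebra_simps)
    also have "(\<Sum>j. t * (\<Sum>r\<in>UNIV. cmat A $ l $ r * (complex_of_real (matpow A j $ r $ k) * t ^ j))) =
       t * (\<Sum>r\<in>UNIV. cmat A $ l $ r * x r t)"
      unfolding x_def by (intro sums_unique[symmetric] sums_mult sums_sum summable_sums summ t)
    finally show ?thesis by (simp add: mat_def)
  qed
  \<comment> \<open>Cramer's rule for that system. It applies where the series are known to
    converge, while \<open>G\<close> continues the result to the larger disc.\<close>
  have Gx: "G t = (1 - c * t) * x i t" if t: "cmod t < 1 / K" "t \<in> ball 0 R" for t
  proof -
    define B where "B = mat 1 - (\<chi> i j. t * cmat A $ i $ j)"
    have "B *v (\<chi> l. x l t) = (\<chi> r. if r = k then 1 else 0)"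
    proof -
      have "((\<chi> i j. t * cmat A $ i $ j) *v (\<chi> l. x l t)) $ r = t * (\<Sum>s\<in>UNIV. cmat A $ r $ s * x s t)" for r
        by (simp add: matrix_vector_mult_def sum_distrib_left mult.assoc)
      then have "(B *v (\<chi> l. x l t)) $ r = (if r = k then 1 else 0)" for r
        using xeq[OF t(1), of r] by (simp add: B_def matrix_vector_mult_diff_rdistrib)
      then show ?thesis by (simp add: vec_eq_iff)
    qed
    then have "Num t = x i t * det B"
      using cramer_lemma[of i B "\<chi> l. x l t"] unfolding Num_def B_def[symmetric] by (simp only: vec_lambda_beta)
    then have "Num t = x i t * ((1 - c * t) * E t)" by (simp add: B_def DE[symmetric] D_def)
    then show ?thesis using ER[OF t(2)] by (simp add: G_def)
  qed
  define F where "F = Abs_fps (\<lambda>j. complex_of_real (matpow A j $ i $ k))"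
  have R0: "R > 0" using e by (simp add: R_def add_nonneg_pos)
  have Frad: "fps_conv_radius F > 0"
  proof -
    have "fps_conv_radius F \<ge> norm (complex_of_real (1 / (2*K)))"
      unfolding fps_conv_radius_def F_def fps_nth_Abs_fps
      by (rule conv_radius_geI, rule summ) (use K in \<open>simp add: norm_divide field_simps\<close>)
    moreover have "norm (complex_of_real (1 / (2*K))) > 0" using K by simp
    ultimately show ?thesis by (metis ereal_less(2) less_le_trans)
  qed
  define Gf where "Gf = fps_expansion G 0"
  have Grad: "fps_conv_radius Gf \<ge> R" unfolding Gf_def
    by (rule conv_radius_fps_expansion) (use holG in simp)
  \<comment> \<open>Agreement of the sums near 0 identifies the coefficients, so the larger radius
    of convergence of \<open>Gf\<close> becomes information about the powers of A.\<close>
  have "Gf = (1 - fps_const c * fps_X) * F"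
  proof (rule eval_fps_eqD)
    show "fps_conv_radius Gf > 0" using Grad R0 by (metis ereal_less(2) less_le_trans)
    have r1: "fps_conv_radius (1 - fps_const c * fps_X) = \<infinity>"
    proof -
      have "1 - fps_const c * fps_X = fps_of_poly [:1, -c:]" by simp
      then show ?thesis by (metis fps_conv_radius_fps_of_poly)
    qed
    then show "fps_conv_radius ((1 - fps_const c * fps_X) * F) > 0"
      using fps_conv_radius_mult[of "1 - fps_const c * fps_X" F] Frad by (simp add: less_le_trans min_def)
    have "eventually (\<lambda>z. z \<in> ball 0 (min R (1/K))) (nhds 0)"
      by (rule eventually_nhds_in_open) (use R0 K in auto)
    moreover have "eventually (\<lambda>z. z \<in> eball 0 (fps_conv_radius F)) (nhds 0)"
      by (rule eventually_nhds_in_open) (use Frad in \<open>auto simp: in_eball_iff zero_ereal_def\<close>)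
    ultimately show "eventually (\<lambda>z. eval_fps Gf z = eval_fps ((1 - fps_const c * fps_X) * F) z) (nhds 0)"
    proof eventually_elim
      case (elim z)
      have "eval_fps Gf z = G z" unfolding Gf_def
        using eval_fps_expansion'[of G 0 "ereal R" z] holG elim by simp
      also have "\<dots> = (1 - c * z) * x i z" using elim by (intro Gx) auto
      also have "x i z = eval_fps F z" by (simp add: x_def eval_fps_def F_def)
      also have "(1 - c * z) = eval_fps (fps_of_poly [:1, -c:]) z" by (simp add: eval_fps_of_poly mult.commute del: fps_of_poly_pCons)
      also have "fps_of_poly [:1, -c:] = 1 - fps_const c * fps_X" by simp
      also have "eval_fps (1 - fps_const c * fps_X) z * eval_fps F z = eval_fps ((1 - fps_const c * fps_X) * F) z"
        using elim r1 by (intro eval_fps_mult[symmetric]) (auto simp: in_eball_iff)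
      finally show ?case .
    qed
  qed
  then have g: "fps_nth Gf 0 = fps_nth F 0" "\<And>j. fps_nth Gf (Suc j) = fps_nth F (Suc j) - c * fps_nth F j"
    by (simp_all add: left_diff_distrib mult.assoc)
  have psum: "(\<Sum>j\<le>N. fps_nth Gf j * (1/c) ^ j) = fps_nth F N / c ^ N" for N
    by (induction N) (use c0 in \<open>auto simp: g field_simps\<close>)
  have "summable (\<lambda>j. fps_nth Gf j * (1/c) ^ j)"
  proof (rule summable_fps)
    have "ereal (norm (1/c)) < ereal R" using e by (simp add: R_def norm_divide)
    then show "ereal (norm (1/c)) < fps_conv_radius Gf" using Grad by (rule less_le_trans)
  qed
  then have "convergent (\<lambda>N. \<Sum>j\<le>N. fps_nth Gf j * (1/c) ^ j)"
    by (simp add: summable_iff_convergent')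
  then show ?thesis unfolding psum F_def by simp
qed

lemma matpow_vec_eigen:
  fixes A :: "real^'n^'n"
  assumes "A *v v = c *s v" shows "matpow A j *v v = c ^ j *s v"
proof (induction j)
  case (Suc j)
  have "matpow A (Suc j) *v v = A *v (c ^ j *s v)" by (simp add: matrix_vector_mul_assoc[symmetric] Suc)
  also have "\<dots> = c ^ Suc j *s v" by (simp only: vector_scalar_commute assms vector_smult_assoc power_Suc2)
  finally show ?case .
qed simp

lemma matpow_add: "matpow A (i + j) = matpow A i ** matpow A j"
  by (induction i) (simp_all add: matrix_mul_assoc)

lemma matpow_mult: "matpow A (i * j) = matpow (matpow A i) j"
  by (induction j) (simp_all add: matpow_add)

text \<open>The matrix is real, so the conjugate of the dominant root is a root of the same modulus;
  strict dominance makes the two equal.\<close>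

lemma proximal_eigenvalue_real:
  assumes "proximal A"
  obtains c :: real where "poly (charpoly A) (of_real c) = 0" "order (of_real c) (charpoly A) = 1"
    "\<And>\<kappa>. poly (charpoly A) \<kappa> = 0 \<Longrightarrow> \<kappa> \<noteq> of_real c \<Longrightarrow> cmod \<kappa> < cmod (of_real c)"
proof -
  obtain c where c: "poly (charpoly A) c = 0" "order c (charpoly A) = 1"
     "\<And>\<kappa>. poly (charpoly A) \<kappa> = 0 \<Longrightarrow> \<kappa> \<noteq> c \<Longrightarrow> cmod \<kappa> < cmod c"
    using assms unfolding proximal_def by blast
  have "cnj (det (mat z - cmat A)) = det (mat (cnj z) - cmat A)" for z
    unfolding det_def cnj_sum
    by (intro sum.cong refl) (auto simp: mat_def cmat_def intro!: prod.cong)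
  then have "poly (charpoly A) (cnj c) = 0" using c(1) by (metis poly_charpoly complex_cnj_zero)
  then have "cnj c = c" using c(3)[of "cnj c"] by auto
  then obtain c' where "c = of_real c'" by (metis Reals_cnj_iff Reals_cases)
  then show ?thesis using c that by blast
qed

text \<open>The entrywise limit satisfies A R = c R, so its image lies in the eigenspace of c, a
  line because c is a simple root. It is nonzero because it fixes an eigenvector.\<close>

lemma proximal_powers_limit:
  fixes A :: "real^'n^'n"
  assumes prox: "proximal A" and inv: "invertible A"
  obtains c :: real and R :: "real^'n^'n" and x :: "real^'n" where
    "c \<noteq> 0" "(\<lambda>j. (1 / c ^ j) *\<^sub>R matpow A j) \<longlonglongrightarrow> R" "R \<noteq> 0" "\<And>v. R *v v \<in> span {x}"
proof -
  obtain c :: real where c: "poly (charpoly A) (of_real c) = 0" "order (of_real c) (charpoly A) = 1"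
    "\<And>\<kappa>. poly (charpoly A) \<kappa> = 0 \<Longrightarrow> \<kappa> \<noteq> of_real c \<Longrightarrow> cmod \<kappa> < cmod (of_real c)"
    using proximal_eigenvalue_real[OF prox] by blast
  have cdet: "det (mat (complex_of_real z) - cmat A) = of_real (det (mat z - A))" for z
    unfolding det_def of_real_sum
    by (intro sum.cong refl) (auto simp: mat_def cmat_def intro!: prod.cong)
  have det0: "det (mat c - A) = 0" using c(1) cdet[of c] by (simp add: poly_charpoly)
  have matv: "mat a *v x = a *s x" for a and x :: "real^'n"
    by (simp add: vec_eq_iff matrix_vector_mult_def mat_def if_distrib if_distribR cong: if_cong)
  obtain x where x: "x \<noteq> 0" "A *v x = c *s x"
  proof -
    have "\<not> invertible (mat c - A)" using det0 by (simp add: invertible_det_nz)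
    then obtain x where "x \<noteq> 0" "(mat c - A) *v x = 0"
      by (metis invertible_left_inverse matrix_left_invertible_ker)
    then show ?thesis using that[of x] by (simp add: matrix_vector_mult_diff_rdistrib matv)
  qed
  have c0: "c \<noteq> 0"
  proof
    assume "c = 0"
    then have "A *v x = 0" using x by simp
    then show False using inv x(1) by (metis invertible_left_inverse matrix_left_invertible_ker)
  qed
  have "convergent (\<lambda>j. matpow A j $ i $ k / c ^ j)" for i k
  proof -
    have "convergent (\<lambda>j. complex_of_real (matpow A j $ i $ k) / of_real c ^ j)"
      by (rule dominant_simple_root_convergence) (use c c0 in auto)
    then obtain l where "(\<lambda>j. complex_of_real (matpow A j $ i $ k / c ^ j)) \<longlonglongrightarrow> l"
      by (auto simp: convergent_def)
    then have "(\<lambda>j. matpow A j $ i $ k / c ^ j) \<longlonglongrightarrow> Re l" by (drule_tac tendsto_Re) simp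
    then show ?thesis by (auto simp: convergent_def)
  qed
  then have R0: "(\<lambda>j. matpow A j $ i $ k / c ^ j) \<longlonglongrightarrow> lim (\<lambda>j. matpow A j $ i $ k / c ^ j)" for i k
    by (simp add: convergent_LIMSEQ_iff)
  define R where "R = (\<chi> i k. lim (\<lambda>j. matpow A j $ i $ k / c ^ j))"
  have lim: "(\<lambda>j. (1 / c ^ j) *\<^sub>R matpow A j) \<longlonglongrightarrow> R"
    by (intro vec_tendstoI) (use R0 in \<open>simp add: R_def\<close>)
  have vlim: "(\<lambda>j. ((1 / c ^ j) *\<^sub>R matpow A j) *v v) \<longlonglongrightarrow> R *v v" for v
    unfolding matrix_vector_mult_def
    by (intro vec_tendstoI) (simp only: vec_lambda_beta, intro tendsto_intros tendsto_vec_nth lim)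
  have "R *v x = x"
  proof -
    have "((1 / c ^ j) *\<^sub>R matpow A j) *v x = x" for j
      using matpow_vec_eigen[OF x(2), of j] c0
      by (simp add: scaleR_matrix_vector_assoc[symmetric] scalar_mult_eq_scaleR)
    then show ?thesis using vlim[of x] by (simp add: LIMSEQ_const_iff)
  qed
  then have "R \<noteq> 0" using x(1) by auto
  moreover have "R *v v \<in> span {x}" for v
  proof -
    have "(\<lambda>j. A *v (((1 / c ^ j) *\<^sub>R matpow A j) *v v)) \<longlonglongrightarrow> A *v (R *v v)"
      by (rule bounded_linear.tendsto[OF matrix_vector_mul_bounded_linear vlim])
    moreover have "A *v (((1 / c ^ j) *\<^sub>R matpow A j) *v v) = c *\<^sub>R (((1 / c ^ Suc j) *\<^sub>R matpow A (Suc j)) *v v)" for j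
      using c0 by (simp add: scaleR_matrix_vector_assoc[symmetric] matrix_vector_mul_assoc[symmetric] matrix_vector_mult_scaleR)
    moreover have "(\<lambda>j. c *\<^sub>R (((1 / c ^ Suc j) *\<^sub>R matpow A (Suc j)) *v v)) \<longlonglongrightarrow> c *\<^sub>R (R *v v)"
      by (intro tendsto_intros LIMSEQ_Suc[OF vlim])
    ultimately have eig: "A *v (R *v v) = c *\<^sub>R (R *v v)"
      by (intro LIMSEQ_unique) simp_all
    \<comment> \<open>Complexification: the eigenspace lemma lives over the complex numbers, and the
      real multiple is recovered as \<open>Re t\<close>.\<close>
    define cv where "cv w = (\<chi> i. complex_of_real (w $ i))" for w :: "real^'n"
    have cv: "cmat A *v cv w = of_real c *s cv w" if "A *v w = c *s w" for w
    proof -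
      have "(cmat A *v cv w) $ i = of_real ((A *v w) $ i)" for i
        by (simp add: cmat_def cv_def matrix_vector_mult_def)
      then show ?thesis unfolding that by (simp add: cv_def vec_eq_iff)
    qed
    have "\<exists>t. cv (R *v v) = t *s cv x"
      by (rule simple_eigenvalue_eigenspace[OF c(2)])
         (use x eig in \<open>auto intro!: cv simp: scalar_mult_eq_scaleR\<close>, auto simp: cv_def vec_eq_iff)
    then obtain t where "cv (R *v v) = t *s cv x" ..
    then have "complex_of_real ((R *v v) $ i) = t * complex_of_real (x $ i)" for i
      by (simp add: cv_def vec_eq_iff)
    then have "(R *v v) $ i = Re t * x $ i" for i
      by (metis Re_complex_of_real Re_complex_of_real times_complex.sel(1) Im_complex_of_real mult_zero_right diff_zero)
    then have "R *v v = Re t *\<^sub>R x" by (simp add: vec_eq_iff)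
    then show ?thesis by (simp add: span_scale span_base)
  qed
  ultimately show ?thesis using that c0 lim by blast
qed

section \<open>Minimal cones of positive mass\<close>

text \<open>The bounded continuous functions on projective space, seen as functions of a nonzero vector. The
  value at 0 is arbitrary.\<close>

definition hom0 :: "(real^'n \<Rightarrow> 'b::euclidean_space) \<Rightarrow> bool" where
  "hom0 f \<longleftrightarrow> continuous_on (-{0}) f \<and> (\<forall>t v. t \<noteq> 0 \<longrightarrow> v \<noteq> 0 \<longrightarrow> f (t *\<^sub>R v) = f v) \<and> bounded (range f)"

lemma hom0_measurable: "hom0 f \<Longrightarrow> f \<in> borel_measurable borel"
proof -
  assume "hom0 f"
  then have "continuous_on (-{0}) f" by (simp add: hom0_def)
  then have "(\<lambda>v. if v \<in> -{0} then f v else f 0) \<in> borel_measurable borel"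
    by (intro borel_measurable_continuous_on_if continuous_on_const) auto
  also have "(\<lambda>v. if v \<in> -{0} then f v else f 0) = f" by auto
  finally show ?thesis .
qed

lemma hom0_scale: "hom0 f \<Longrightarrow> t \<noteq> 0 \<Longrightarrow> v \<noteq> 0 \<Longrightarrow> f (t *\<^sub>R v) = f v"
  by (simp add: hom0_def)

lemma hom0_bound:
  assumes "hom0 f" obtains B where "B \<ge> 0" "\<And>v. norm (f v) \<le> B"
  using assms unfolding hom0_def bounded_iff by (metis norm_ge_zero order_trans rangeI)

lemma hom0_tendsto:
  assumes "hom0 f" "X \<longlonglongrightarrow> x" "x \<noteq> 0" shows "(\<lambda>j. f (X j)) \<longlonglongrightarrow> f x"
proof -
  have "isCont f x" using assms(1,3) by (simp add: hom0_def continuous_on_eq_continuous_at open_Compl)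
  then show ?thesis using assms(2) by (rule isCont_tendsto_compose)
qed

lemma invertible_mult_nonzero: "invertible (g :: real^'n^'n) \<Longrightarrow> v \<noteq> 0 \<Longrightarrow> g *v v \<noteq> 0"
  by (metis invertible_left_inverse matrix_left_invertible_ker)

lemma hom0_comp_invertible:
  assumes "hom0 f" "invertible (b :: real^'n^'n)" shows "hom0 (\<lambda>v. f (b *v v))"
  unfolding hom0_def
proof (intro conjI allI impI)
  show "continuous_on (-{0}) (\<lambda>v. f (b *v v))"
    by (rule continuous_on_compose2[of "-{0}" f])
       (use assms in \<open>auto simp: hom0_def dest: invertible_mult_nonzero intro!: linear_continuous_on matrix_vector_mul_bounded_linear\<close>)
  show "bounded (range (\<lambda>v. f (b *v v)))"
    using assms(1) unfolding hom0_def by (auto intro: bounded_subset)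
qed (use assms in \<open>auto simp: hom0_def matrix_vector_mult_scaleR invertible_mult_nonzero\<close>)

section \<open>Closed cones and the normalised distance to them\<close>

definition closed_cone :: "(real^'n) set \<Rightarrow> bool" where
  "closed_cone C \<longleftrightarrow> closed C \<and> (\<forall>t v. v \<in> C \<longrightarrow> t *\<^sub>R v \<in> C)"

lemma closed_cone_scale_iff: "closed_cone C \<Longrightarrow> t \<noteq> 0 \<Longrightarrow> t *\<^sub>R v \<in> C \<longleftrightarrow> v \<in> C"
proof
  assume "closed_cone C" "t \<noteq> 0" "t *\<^sub>R v \<in> C"
  then have "(1/t) *\<^sub>R (t *\<^sub>R v) \<in> C" unfolding closed_cone_def by blast
  then show "v \<in> C" using \<open>t \<noteq> 0\<close> by simp
qed (auto simp: closed_cone_def)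

text \<open>Division by the norm makes the distance a function on lines. For the empty cone it is 0
  everywhere, because \<open>infdist\<close> to the empty set is 0.\<close>

definition cdist :: "(real^'n) set \<Rightarrow> real^'n \<Rightarrow> real" where
  "cdist C v = infdist v C / norm v"

text \<open>Comparison with the points t a of the cone gives one inequality for every nonzero t; the
  same inequality for 1/t at the vector t v gives the converse.\<close>

lemma infdist_scale_cone:
  assumes "closed_cone C" "t \<noteq> 0"
  shows "infdist (t *\<^sub>R v) C = \<bar>t\<bar> * infdist v C"
proof (cases "C = {}")
  case False
  have le: "infdist (t *\<^sub>R v) C \<le> \<bar>t\<bar> * infdist v C" if "t \<noteq> 0" for t v
  proof -
    have "infdist (t *\<^sub>R v) C / \<bar>t\<bar> \<le> dist v a" if "a \<in> C" for a
    proof -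
      have "infdist (t *\<^sub>R v) C \<le> dist (t *\<^sub>R v) (t *\<^sub>R a)"
        using that assms(1) by (intro infdist_le) (auto simp: closed_cone_def)
      also have "\<dots> = \<bar>t\<bar> * dist v a" by (simp add: dist_norm scaleR_diff_right[symmetric])
      finally show ?thesis using \<open>t \<noteq> 0\<close> by (simp add: field_simps)
    qed
    then have "infdist (t *\<^sub>R v) C / \<bar>t\<bar> \<le> infdist v C"
      using False unfolding infdist_notempty[OF False, of v] by (intro cINF_greatest) auto
    then show ?thesis using \<open>t \<noteq> 0\<close> by (simp add: field_simps)
  qed
  have "infdist ((1/t) *\<^sub>R (t *\<^sub>R v)) C \<le> \<bar>1/t\<bar> * infdist (t *\<^sub>R v) C" using assms by (intro le) auto
  then have "\<bar>t\<bar> * infdist v C \<le> infdist (t *\<^sub>R v) C" using assms by (simp add: field_simps)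
  then show ?thesis using le[OF assms(2), of v] by simp
qed (simp add: infdist_def)

lemma closed_cone_zero: "closed_cone C \<Longrightarrow> C \<noteq> {} \<Longrightarrow> 0 \<in> C"
  unfolding closed_cone_def by (metis all_not_in_conv scaleR_zero_left)

lemma cdist_bounds: assumes "closed_cone C" shows "0 \<le> cdist C v" "cdist C v \<le> 1"
proof -
  show "0 \<le> cdist C v" by (simp add: cdist_def infdist_nonneg)
  show "cdist C v \<le> 1"
  proof (cases "C = {} \<or> v = 0")
    case False
    then have "infdist v C \<le> dist v 0" using assms by (intro infdist_le closed_cone_zero) auto
    then show ?thesis using False by (simp add: cdist_def)
  qed (auto simp: cdist_def infdist_def)
qed

lemma cdist_eq_0_iff: "closed_cone C \<Longrightarrow> C \<noteq> {} \<Longrightarrow> v \<noteq> 0 \<Longrightarrow> cdist C v = 0 \<longleftrightarrow> v \<in> C"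
  unfolding cdist_def closed_cone_def using in_closed_iff_infdist_zero[of C v] by auto

lemma hom0_cdist: "closed_cone C \<Longrightarrow> hom0 (cdist C)"
  unfolding hom0_def bounded_iff
proof (intro conjI allI impI)
  show "closed_cone C \<Longrightarrow> continuous_on (- {0}) (cdist C)"
    unfolding cdist_def by (intro continuous_intros) auto
  show "closed_cone C \<Longrightarrow> \<exists>a. \<forall>x\<in>range (cdist C). norm x \<le> a"
    by (rule exI[of _ 1]) (auto simp: cdist_bounds)
qed (simp add: cdist_def infdist_scale_cone)

lemma closed_cone_vimage: "closed_cone C \<Longrightarrow> closed_cone ((\<lambda>v. b *v v) -` C)"
  unfolding closed_cone_def
  by (auto simp: matrix_vector_mult_scaleR intro!: closed_vimage linear_continuous_on matrix_vector_mul_bounded_linear)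

lemma measurable_mat_vec [measurable]:
  fixes f :: "'a \<Rightarrow> real^'n^'n"
  assumes [measurable]: "f \<in> borel_measurable M" "h \<in> borel_measurable M"
  shows "(\<lambda>x. f x *v h x) \<in> borel_measurable M"
  by (rule borel_measurable_continuous_Pair[OF assms])
     (auto simp: matrix_vector_mult_def intro!: continuous_intros)

lemma measurable_mat_mat [measurable]:
  fixes f h :: "'a \<Rightarrow> real^'n^'n"
  assumes [measurable]: "f \<in> borel_measurable M" "h \<in> borel_measurable M"
  shows "(\<lambda>x. f x ** h x) \<in> borel_measurable M"
  by (rule borel_measurable_continuous_Pair[OF assms])
     (auto simp: matrix_matrix_mult_def intro!: continuous_intros)

lemma tendsto_mat_vec:
  fixes X :: "'a \<Rightarrow> real^'n^'m"
  assumes "(X \<longlongrightarrow> g) F" "(Y \<longlongrightarrow> y) F"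
  shows "((\<lambda>j. X j *v Y j) \<longlongrightarrow> g *v y) F"
  unfolding matrix_vector_mult_def
  by (intro vec_tendstoI) (simp only: vec_lambda_beta, intro tendsto_intros tendsto_vec_nth assms)

lemma tendsto_mat_mat:
  fixes X :: "'a \<Rightarrow> real^'n^'m" and Y :: "'a \<Rightarrow> real^'k^'n"
  assumes "(X \<longlongrightarrow> g) F" "(Y \<longlongrightarrow> h) F"
  shows "((\<lambda>j. X j ** Y j) \<longlongrightarrow> g ** h) F"
  unfolding matrix_matrix_mult_def
  by (intro vec_tendstoI) (simp only: vec_lambda_beta, intro tendsto_intros tendsto_vec_nth assms)

text \<open>The measures live on full Euclidean spaces, with invertibility and nonvanishing holding
  almost surely. \<open>G_least\<close> states the minimality of \<open>\<Gamma>\<close> as an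
  induction principle for semigroups that are sequentially closed among invertible matrices and
  contain the support of \<open>m\<close>.\<close>

locale matrix_walk =
  fixes m :: "(real^'n^'n) measure" and \<rho> :: "(real^'n) measure" and G :: "(real^'n^'n) set"
  assumes prob_m: "prob_space m" and sets_m [measurable_cong]: "sets m = sets borel"
    and m_inv: "AE g in m. invertible g"
    and prob_rho: "prob_space \<rho>" and sets_rho [measurable_cong]: "sets \<rho> = sets borel"
    and rho_nz: "AE v in \<rho>. v \<noteq> 0"
    and stat: "\<And>f :: real^'n \<Rightarrow> real. hom0 f \<Longrightarrow> (\<integral>v. (\<integral>g. f (g *v v) \<partial>m) \<partial>\<rho>) = (\<integral>v. f v \<partial>\<rho>)"
    and G_inv: "\<And>g. g \<in> G \<Longrightarrow> invertible g"
    and G_mult: "\<And>a b. a \<in> G \<Longrightarrow> b \<in> G \<Longrightarrow> a ** b \<in> G"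
    and G_least: "\<And>S. (\<And>g. g \<in> S \<Longrightarrow> invertible g) \<Longrightarrow>
        (\<And>X g. (\<And>j::nat. X j \<in> S) \<Longrightarrow> X \<longlonglongrightarrow> g \<Longrightarrow> invertible g \<Longrightarrow> g \<in> S) \<Longrightarrow>
        (\<And>a b. a \<in> S \<Longrightarrow> b \<in> S \<Longrightarrow> a ** b \<in> S) \<Longrightarrow>
        (\<And>g. invertible g \<Longrightarrow> (\<And>U. open U \<Longrightarrow> g \<in> U \<Longrightarrow> measure m U > 0) \<Longrightarrow> g \<in> S) \<Longrightarrow> G \<subseteq> S"
    and irred: "strongly_irreducible G"
begin

sublocale m: prob_space m by (rule prob_m)
sublocale \<rho>: prob_space \<rho> by (rule prob_rho)
sublocale mr: pair_prob_space m \<rho> ..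

lemma sets_rho_closed [measurable]: "closed A \<Longrightarrow> A \<in> sets \<rho>"
  by (simp add: sets_rho)

lemma space_m [simp]: "space m = UNIV" using sets_eq_imp_space_eq[OF sets_m] by simp
lemma space_rho [simp]: "space \<rho> = UNIV" using sets_eq_imp_space_eq[OF sets_rho] by simp

lemma stat_swap:
  fixes f :: "real^'n \<Rightarrow> real"
  assumes f: "hom0 f"
  shows "(\<integral>g. (\<integral>v. f (g *v v) \<partial>\<rho>) \<partial>m) = (\<integral>v. f v \<partial>\<rho>)"
proof -
  note [measurable] = hom0_measurable[OF f]
  obtain B where B: "\<And>v. \<bar>f v\<bar> \<le> B" using hom0_bound[OF f] by (metis real_norm_def)
  have "integrable (m \<Otimes>\<^sub>M \<rho>) (\<lambda>(g, v). f (g *v v))"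
    by (rule mr.integrable_const_bound[of _ B]) (auto simp: B split_beta)
  then have "(\<integral>v. (\<integral>g. f (g *v v) \<partial>m) \<partial>\<rho>) = (\<integral>g. (\<integral>v. f (g *v v) \<partial>\<rho>) \<partial>m)"
    by (rule mr.Fubini_integral)
  then show ?thesis using stat[OF f] by simp
qed

text \<open>Stationarity is given for continuous functions. The functions 1 / (1 + n cdist) are
  continuous on lines, equal 1 on \<open>C\<close> and tend to 0 off \<open>C\<close>, so dominated
  convergence passes the identity on to the indicator.\<close>

lemma stat_closed_cone:
  assumes C: "closed_cone C"
  shows "(\<integral>g. measure \<rho> ((\<lambda>v. g *v v) -` C) \<partial>m) = measure \<rho> C"
\<comment> \<open>For the empty cone \<open>cdist\<close> is 0 and the approximation would tend to 1
  instead of 0.\<close>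
proof (cases "C = {}")
  case False
  define f where "f n v = 1 / (1 + real n * cdist C v)" for n v
  have nz: "1 + real n * cdist C v > 0" for n v
    using cdist_bounds[OF C] by (simp add: add_pos_nonneg)
  have fb: "\<bar>f n v\<bar> \<le> 1" for n v
    using cdist_bounds[OF C, of v] nz[of n v] by (simp add: f_def)
  have hf: "hom0 (f n)" for n
  proof -
    have "continuous_on (-{0}) (f n)" unfolding f_def
      using hom0_cdist[OF C] nz by (intro continuous_intros) (auto simp: hom0_def less_imp_neq[THEN not_sym])
    moreover have "bounded (range (f n))" unfolding bounded_iff using fb by auto
    ultimately show ?thesis using hom0_cdist[OF C] by (simp add: hom0_def f_def)
  qed
  note [measurable] = hom0_measurable[OF hf]
  have Cb [measurable]: "C \<in> sets borel" using C by (simp add: closed_cone_def)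
  have lim: "(\<lambda>n. f n v) \<longlonglongrightarrow> indicator C v" if "v \<noteq> 0" for v
  proof (cases "v \<in> C")
    case True
    then have "f n v = 1" for n using cdist_eq_0_iff[OF C False that] by (simp add: f_def)
    then show ?thesis using True by simp
  next
    case v: False
    then have d: "cdist C v > 0"
      using cdist_eq_0_iff[OF C False that] cdist_bounds(1)[OF C, of v] by (simp add: less_le)
    have "filterlim (\<lambda>n. 1 + real n * cdist C v) at_top sequentially"
      by (intro filterlim_tendsto_add_at_top[OF tendsto_const]
          filterlim_at_top_mult_tendsto_pos[OF tendsto_const d] filterlim_real_sequentially)
    then have "(\<lambda>n. 1 / (1 + real n * cdist C v)) \<longlonglongrightarrow> 0"
      by (rule tendsto_divide_0[OF tendsto_const filterlim_at_top_imp_at_infinity])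
    then show ?thesis using v by (simp add: f_def)
  qed
  have in1: "(\<lambda>n. \<integral>v. f n (g *v v) \<partial>\<rho>) \<longlonglongrightarrow> measure \<rho> ((\<lambda>v. g *v v) -` C)" if g: "invertible g" for g
  proof -
    have "(\<lambda>n. \<integral>v. f n (g *v v) \<partial>\<rho>) \<longlonglongrightarrow> (\<integral>v. indicator ((\<lambda>v. g *v v) -` C) v \<partial>\<rho>)"
    proof (rule integral_dominated_convergence[where w="\<lambda>_. 1"])
      show "AE v in \<rho>. (\<lambda>n. f n (g *v v)) \<longlonglongrightarrow> indicator ((\<lambda>v. g *v v) -` C) v"
        using rho_nz by eventually_elim (use lim[OF invertible_mult_nonzero[OF g]] in \<open>simp add: indicator_def\<close>)
      have "closed ((\<lambda>v. g *v v) -` C)" using closed_cone_vimage[OF C, of g] unfolding closed_cone_def by blast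
      then show "(indicator ((\<lambda>v. g *v v) -` C) :: _ \<Rightarrow> real) \<in> borel_measurable \<rho>" by simp
    qed (auto simp: fb)
    then show ?thesis by simp
  qed
  have "(\<lambda>n. \<integral>g. (\<integral>v. f n (g *v v) \<partial>\<rho>) \<partial>m) \<longlonglongrightarrow> (\<integral>g. measure \<rho> ((\<lambda>v. g *v v) -` C) \<partial>m)"
  proof (rule integral_dominated_convergence[where w="\<lambda>_. 1"])
    show "AE g in m. (\<lambda>n. \<integral>v. f n (g *v v) \<partial>\<rho>) \<longlonglongrightarrow> measure \<rho> ((\<lambda>v. g *v v) -` C)"
      using m_inv by (auto elim!: eventually_mono intro: in1)
    have 2: "{p. fst p *v snd p \<in> C} \<in> sets (m \<Otimes>\<^sub>M \<rho>)"
    proof -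
      have "(\<lambda>p. fst p *v snd p) -` C \<inter> space (m \<Otimes>\<^sub>M \<rho>) \<in> sets (m \<Otimes>\<^sub>M \<rho>)"
        by (rule measurable_sets[of _ _ borel]) auto
      then show ?thesis by (simp add: space_pair_measure vimage_def)
    qed
    have "(\<lambda>g. measure \<rho> (Pair g -` {p. fst p *v snd p \<in> C})) \<in> borel_measurable m"
      unfolding measure_def using \<rho>.measurable_emeasure_Pair[OF 2] by measurable
    then show "(\<lambda>g. measure \<rho> ((\<lambda>v. g *v v) -` C)) \<in> borel_measurable m"
      by (simp add: vimage_def)
    show "AE g in m. norm (\<integral>v. f n (g *v v) \<partial>\<rho>) \<le> 1" for n
    proof (intro AE_I2)
      fix g
      have "norm (\<integral>v. f n (g *v v) \<partial>\<rho>) \<le> (\<integral>v. norm (f n (g *v v)) \<partial>\<rho>)" by (rule integral_norm_bound)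
      also have "\<dots> \<le> 1" by (rule \<rho>.integral_le_const) (auto simp: fb intro!: \<rho>.integrable_const_bound[of _ 1])
      finally show "norm (\<integral>v. f n (g *v v) \<partial>\<rho>) \<le> 1" .
    qed
  qed auto
  then have "(\<lambda>n. \<integral>v. f n v \<partial>\<rho>) \<longlonglongrightarrow> (\<integral>g. measure \<rho> ((\<lambda>v. g *v v) -` C) \<partial>m)"
    by (simp add: stat_swap[OF hf])
  moreover have "(\<lambda>n. \<integral>v. f n v \<partial>\<rho>) \<longlonglongrightarrow> (\<integral>v. indicator C v \<partial>\<rho>)"
    by (rule integral_dominated_convergence[where w="\<lambda>_. 1"])
       (use rho_nz lim fb in \<open>auto elim!: eventually_mono\<close>)
  ultimately show ?thesis by (simp add: LIMSEQ_unique)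
qed simp

end

text \<open>\<open>rk\<close> stands in for dimension. The two instances are linear subspaces with
  \<open>dim\<close> and polynomial cones with \<open>poly_rank\<close>.\<close>

locale cone_family =
  fixes \<A> :: "(real^'n) set set" and rk :: "(real^'n) set \<Rightarrow> nat"
  assumes cone: "A \<in> \<A> \<Longrightarrow> closed_cone A"
    and UNIV_in: "UNIV \<in> \<A>"
    and Int_in: "A \<in> \<A> \<Longrightarrow> B \<in> \<A> \<Longrightarrow> A \<inter> B \<in> \<A>"
    and vimage_in: "A \<in> \<A> \<Longrightarrow> invertible g \<Longrightarrow> (\<lambda>v. g *v v) -` A \<in> \<A>"
    and rk_strict: "A \<in> \<A> \<Longrightarrow> B \<in> \<A> \<Longrightarrow> A \<subset> B \<Longrightarrow> rk A < rk B"
    and rk_vimage: "A \<in> \<A> \<Longrightarrow> invertible g \<Longrightarrow> rk ((\<lambda>v. g *v v) -` A) = rk A"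

locale walk_family = matrix_walk m \<rho> G + cone_family \<A> rk
  for m :: "(real^'n^'n) measure" and \<rho> G and \<A> :: "(real^'n) set set" and rk
begin

text \<open>The maximal mass \<open>a\<close> of a cone in \<open>F\<close> is the average over g of
  the masses of its preimages; none exceeds \<open>a\<close>, so almost all attain it. The matrices
  preserving \<open>F\<close> thus have full measure and form a closed subsemigroup, which contains
  \<open>G\<close>.\<close>

lemma minimal_cones:
  obtains F where "finite F" "F \<noteq> {}" "F \<subseteq> \<A>"
    "\<And>Z. Z \<in> F \<Longrightarrow> 0 < measure \<rho> Z"
    "\<And>Z A. Z \<in> F \<Longrightarrow> A \<in> \<A> \<Longrightarrow> A \<subset> Z \<Longrightarrow> measure \<rho> A = 0"
    "\<And>Z. Z \<in> F \<Longrightarrow> span Z = UNIV"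
    "AE g in m. \<forall>Z\<in>F. (\<lambda>v. g *v v) -` Z \<in> F"
    "\<And>g Z. g \<in> G \<Longrightarrow> Z \<in> F \<Longrightarrow> (\<lambda>v. g *v v) -` Z \<in> F"
proof -
  have sets_A [measurable]: "A \<in> \<A> \<Longrightarrow> A \<in> sets \<rho>" for A
    using cone by (auto simp: closed_cone_def)
  define r where "r = (LEAST k. \<exists>A\<in>\<A>. rk A = k \<and> 0 < measure \<rho> A)"
  have ex: "\<exists>k. \<exists>A\<in>\<A>. rk A = k \<and> 0 < measure \<rho> A"
    using UNIV_in \<rho>.prob_space by (auto intro!: bexI[of _ UNIV])
  from LeastI_ex[OF ex] obtain A0 where A0: "A0 \<in> \<A>" "rk A0 = r" "0 < measure \<rho> A0"
    unfolding r_def by blast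
  have small: "measure \<rho> A = 0" if "A \<in> \<A>" "rk A < r" for A
  proof (rule ccontr)
    assume "measure \<rho> A \<noteq> 0"
    then have "r \<le> rk A" unfolding r_def using that by (intro Least_le) (auto simp: zero_less_measure_iff)
    then show False using that by simp
  qed
  define \<A>r where "\<A>r = {A\<in>\<A>. rk A = r}"
  have inter: "measure \<rho> (A \<inter> B) = 0" if "A \<in> \<A>r" "B \<in> \<A>r" "A \<noteq> B" for A B
  proof -
    have AB: "A \<in> \<A>" "B \<in> \<A>" "A \<inter> B \<in> \<A>" and rk: "rk A = r" "rk B = r"
      using that(1,2) Int_in by (auto simp: \<A>r_def)
    have "A \<inter> B \<subset> A \<or> A \<inter> B \<subset> B" using that(3) by blast
    then have "rk (A \<inter> B) < r" using rk_strict[OF AB(3,1)] rk_strict[OF AB(3,2)] rk by metis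
    then show ?thesis by (rule small[OF AB(3)])
  qed
  have eqI: "A = B" if "A \<in> \<A>r" "B \<in> \<A>r" "A \<subseteq> B" for A B
    using that rk_strict[of A B] unfolding \<A>r_def by auto
  \<comment> \<open>Different cones of minimal rank overlap in null sets, so their masses add up to
    at most 1, which leaves room for at most 1/\<open>\<epsilon>\<close> cones of mass
    \<open>\<epsilon>\<close> or more.\<close>
  have fin: "finite {A\<in>\<A>r. \<epsilon> \<le> measure \<rho> A}" if "\<epsilon> > 0" for \<epsilon>
  proof -
    have "card T \<le> nat \<lfloor>1 / \<epsilon>\<rfloor>" if T: "T \<subseteq> {A\<in>\<A>r. \<epsilon> \<le> measure \<rho> A}" "finite T" for T
    proof -
      have "real (card T) * \<epsilon> \<le> (\<Sum>A\<in>T. measure \<rho> A)"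
        using T(1) by (intro sum_bounded_below) auto
      also have "\<dots> = measure \<rho> (\<Union>A\<in>T. A)"
      proof (rule measure_UNION_AE[symmetric, OF T(2)])
        show "A \<in> fmeasurable \<rho>" if "A \<in> T" for A
          using that T by (auto simp: \<A>r_def \<rho>.fmeasurable_eq_sets)
        show "pairwise (\<lambda>A B. AE x in \<rho>. x \<notin> A \<or> x \<notin> B) T"
        proof (intro pairwiseI)
          fix A B assume AB: "A \<in> T" "B \<in> T" "A \<noteq> B"
          then have "A \<inter> B \<in> null_sets \<rho>"
            using inter[of A B] T(1) Int_in by (auto simp: \<A>r_def null_sets_def \<rho>.emeasure_eq_measure subset_iff)
          then show "AE x in \<rho>. x \<notin> A \<or> x \<notin> B"
            by (auto dest!: AE_not_in elim!: eventually_mono)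
        qed
      qed
      also have "\<dots> \<le> 1" by simp
      finally have "real (card T) \<le> 1 / \<epsilon>" using that by (simp add: \<open>\<epsilon> > 0\<close> field_simps)
      then show ?thesis by (simp add: le_nat_floor)
    qed
    then show ?thesis by (metis (lifting) finite_if_finite_subsets_card_bdd)
  qed
  \<comment> \<open>There may be infinitely many cones of minimal rank; only those at least as heavy
    as \<open>A0\<close> compete, and \<open>fin\<close> makes these finite in number.\<close>
  define a where "a = Max (measure \<rho> ` {A\<in>\<A>r. measure \<rho> A0 \<le> measure \<rho> A})"
  have ne: "{A\<in>\<A>r. measure \<rho> A0 \<le> measure \<rho> A} \<noteq> {}" using A0 by (auto simp: \<A>r_def)
  have a_max: "measure \<rho> A \<le> a" if "A \<in> \<A>r" for A
  proof (cases "measure \<rho> A0 \<le> measure \<rho> A")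
    case True then show ?thesis unfolding a_def using that fin[OF A0(3)] by (intro Max_ge) auto
  next
    case False
    moreover have "measure \<rho> A0 \<le> a" unfolding a_def using A0 fin[OF A0(3)]
      by (intro Max_ge) (auto simp: \<A>r_def)
    ultimately show ?thesis by simp
  qed
  have "a \<in> measure \<rho> ` {A\<in>\<A>r. measure \<rho> A0 \<le> measure \<rho> A}"
    unfolding a_def using ne fin[OF A0(3)] by (intro Max_in) auto
  then obtain A1 where A1: "A1 \<in> \<A>r" "measure \<rho> A1 = a" "measure \<rho> A0 \<le> a" by auto
  have a0: "a > 0" using A1 A0 by simp
  define F where "F = {A\<in>\<A>r. measure \<rho> A = a}"
  have F_fin: "finite F" by (rule finite_subset[OF _ fin[OF a0]]) (auto simp: F_def)
  have F_ne: "F \<noteq> {}" using A1 by (auto simp: F_def)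
  have F_A: "F \<subseteq> \<A>" by (auto simp: F_def \<A>r_def)
  have F_cone: "closed_cone Z" if "Z \<in> F" for Z using that F_A cone by auto
  have r_vim: "(\<lambda>v. g *v v) -` Z \<in> \<A>r" if "Z \<in> \<A>r" "invertible g" for g Z
    using that by (simp add: \<A>r_def vimage_in rk_vimage)
  have AE1: "AE g in m. (\<lambda>v. g *v v) -` Z \<in> F" if Z: "Z \<in> F" for Z
  proof -
    have le: "AE g in m. measure \<rho> ((\<lambda>v. g *v v) -` Z) \<le> a"
      using m_inv by eventually_elim (use Z in \<open>auto intro!: a_max r_vim simp: F_def\<close>)
    have eq: "(\<integral>g. measure \<rho> ((\<lambda>v. g *v v) -` Z) \<partial>m) = a"
      using stat_closed_cone[OF F_cone[OF Z]] Z by (simp add: F_def)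
    \<comment> \<open>A non-integrable function has Bochner integral 0, whereas this integral is
      \<open>a > 0\<close>.\<close>
    have int: "integrable m (\<lambda>g. measure \<rho> ((\<lambda>v. g *v v) -` Z))"
      using a0 eq not_integrable_integral_eq by force
    have "AE g in m. a - measure \<rho> ((\<lambda>v. g *v v) -` Z) = 0"
    proof (subst integral_nonneg_eq_0_iff_AE[symmetric])
      show "(\<integral>g. a - measure \<rho> ((\<lambda>v. g *v v) -` Z) \<partial>m) = 0"
        using int eq m.prob_space by simp
    qed (use int le in auto)
    then show ?thesis using m_inv
      by eventually_elim (use Z r_vim in \<open>auto simp: F_def\<close>)
  qed
  have AEF: "AE g in m. \<forall>Z\<in>F. (\<lambda>v. g *v v) -` Z \<in> F"
    using AE1 F_fin by (simp add: AE_finite_all)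
  define H where "H = {g. invertible g \<and> (\<forall>Z\<in>F. (\<lambda>v. g *v v) -` Z \<in> F)}"
  have Hlim: "g \<in> H" if X: "\<And>j::nat. X j \<in> H" "X \<longlonglongrightarrow> g" and g: "invertible g" for X g
  proof -
    have "(\<lambda>v. g *v v) -` Z \<in> F" if Z: "Z \<in> F" for Z
    proof -
      \<comment> \<open>\<open>F\<close> is finite, so infinitely many terms of the sequence share
        one preimage.\<close>
      have "\<exists>Z'\<in>F. \<exists>\<^sub>\<infinity>j. (\<lambda>v. X j *v v) -` Z = Z'"
      proof (rule ccontr)
        assume "\<not> ?thesis"
        then have "\<forall>Z'\<in>F. eventually (\<lambda>j. (\<lambda>v. X j *v v) -` Z \<noteq> Z') sequentially"
          by (simp add: INFM_iff_infinite frequently_cofinite[symmetric] frequently_def cofinite_eq_sequentially)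
        then have "eventually (\<lambda>j. \<forall>Z'\<in>F. (\<lambda>v. X j *v v) -` Z \<noteq> Z') sequentially"
          using F_fin by (simp add: eventually_ball_finite)
        then obtain j where "\<forall>Z'\<in>F. (\<lambda>v. X j *v v) -` Z \<noteq> Z'" by (auto simp: eventually_sequentially)
        then show False using X(1)[of j] Z by (auto simp: H_def)
      qed
      then obtain Z' where Z': "Z' \<in> F" "\<exists>\<^sub>\<infinity>j. (\<lambda>v. X j *v v) -` Z = Z'" by blast
      obtain s :: "nat \<Rightarrow> nat" where s: "strict_mono s" "\<And>j. (\<lambda>v. X (s j) *v v) -` Z = Z'"
        using infinite_enumerate[of "{j. (\<lambda>v. X j *v v) -` Z = Z'}"] Z'(2)
        by (auto simp: INFM_iff_infinite)
      \<comment> \<open>Closedness of \<open>Z\<close> gives only this inclusion in the limit;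
        equality follows because both cones have minimal rank.\<close>
      have "Z' \<subseteq> (\<lambda>v. g *v v) -` Z"
      proof
        fix v assume v: "v \<in> Z'"
        have "(X \<circ> s) \<longlonglongrightarrow> g" using X(2) s(1) by (rule LIMSEQ_subseq_LIMSEQ)
        then have "(\<lambda>j. X (s j) *v v) \<longlonglongrightarrow> g *v v"
          unfolding o_def by (rule tendsto_mat_vec[OF _ tendsto_const])
        moreover have "X (s j) *v v \<in> Z" for j using v s(2)[of j] by auto
        moreover have "closed Z" using F_cone[OF Z] by (simp add: closed_cone_def)
        ultimately have "g *v v \<in> Z" using closed_sequentially[of Z "\<lambda>j. X (s j) *v v"] by blast
        then show "v \<in> (\<lambda>v. g *v v) -` Z" by simp
      qed
      then have "Z' = (\<lambda>v. g *v v) -` Z"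
        using Z Z'(1) g by (intro eqI r_vim) (auto simp: F_def)
      then show ?thesis using Z' by simp
    qed
    then show ?thesis using g by (simp add: H_def)
  qed
  have GH: "G \<subseteq> H"
  proof (rule G_least)
    show "invertible g" if "g \<in> H" for g using that by (simp add: H_def)
    show "g \<in> H" if "\<And>j::nat. X j \<in> H" "X \<longlonglongrightarrow> g" "invertible g" for X g
      using that by (rule Hlim)
    show "a ** b \<in> H" if "a \<in> H" "b \<in> H" for a b
    proof -
      have "(\<lambda>v. (a ** b) *v v) -` Z = (\<lambda>v. b *v v) -` ((\<lambda>v. a *v v) -` Z)" for Z
        by (auto simp: matrix_vector_mul_assoc)
      then show ?thesis using that by (simp add: H_def invertible_mult)
    qed
    show "g \<in> H" if g: "invertible g" and pos: "\<And>U. open U \<Longrightarrow> g \<in> U \<Longrightarrow> measure m U > 0" for g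
    proof -
      \<comment> \<open>\<open>H\<close> has full measure and each ball about a point of the support
        has positive measure, so the two meet.\<close>
      have "\<exists>h\<in>H. dist h g < 1 / real (Suc j)" for j
      proof (rule ccontr)
        assume no: "\<not> ?thesis"
        have "AE h in m. h \<in> H" using m_inv AEF by eventually_elim (simp add: H_def)
        then have "AE h in m. h \<notin> ball g (1 / real (Suc j))"
          by eventually_elim (use no in \<open>auto simp: dist_commute not_less\<close>)
        then have "measure m (ball g (1 / real (Suc j))) = 0"
          by (subst (asm) m.prob_eq_0[symmetric]) (auto simp: sets_m)
        then show False using pos[of "ball g (1 / real (Suc j))"] by simp
      qed
      then obtain X where X: "\<And>j. X j \<in> H" "\<And>j. dist (X j) g < 1 / real (Suc j)" by metis
      have "X \<longlonglongrightarrow> g"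
      proof (rule tendsto_dist_iff[THEN iffD2, OF tendsto_sandwich[OF _ _ tendsto_const LIMSEQ_Suc[OF lim_1_over_n]]])
      qed (use X(2) in \<open>auto simp: less_imp_le\<close>)
      then show ?thesis by (rule Hlim[OF X(1) _ g])
    qed
  qed
  have GF: "(\<lambda>v. g *v v) -` Z \<in> F" if "g \<in> G" "Z \<in> F" for g Z
    using GH that by (auto simp: H_def)
  have spn: "span Z = UNIV" if Z0: "Z \<in> F" for Z
  proof (rule ccontr)
    assume nU: "span Z \<noteq> UNIV"
    \<comment> \<open>The proper spans of members of \<open>F\<close> would form a finite invariant
      family of the kind excluded by strong irreducibility.\<close>
    define W where "W = span ` {Z\<in>F. span Z \<noteq> UNIV}"
    have "\<forall>V\<in>W. subspace V \<and> V \<noteq> {0} \<and> V \<noteq> UNIV"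
    proof (intro ballI conjI)
      fix V assume "V \<in> W"
      then obtain Z where Z: "Z \<in> F" "V = span Z" "span Z \<noteq> UNIV" by (auto simp: W_def)
      show "subspace V" using Z by simp
      show "V \<noteq> UNIV" using Z by simp
      show "V \<noteq> {0}"
      proof
        assume "V = {0}"
        then have "Z \<subseteq> {0}" using Z span_superset[of Z] by auto
        then have "AE v in \<rho>. v \<notin> Z" using rho_nz by (auto elim!: eventually_mono)
        then have "measure \<rho> Z = 0"
          using Z(1) F_A by (subst (asm) \<rho>.prob_eq_0[symmetric]) auto
        then show False using Z(1) a0 by (simp add: F_def)
      qed
    qed
    moreover have "(\<lambda>v. g *v v) ` (\<Union>W) \<subseteq> \<Union>W" if g: "g \<in> G" for g
    proof safe
      fix V v assume "V \<in> W" "v \<in> V"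
      then obtain Z where Z: "Z \<in> F" "v \<in> span Z" "span Z \<noteq> UNIV" by (auto simp: W_def)
      have ginv: "invertible g" using G_inv[OF g] .
      have sj: "surj (\<lambda>v. g *v v)" using ginv by (simp add: invertible_right_inverse matrix_right_invertible_surjective)
      \<comment> \<open>Taking preimages is injective on the finite set \<open>F\<close>, hence
        onto, so images of members are members as well.\<close>
      have "inj_on (\<lambda>Z. (\<lambda>v. g *v v) -` Z) F"
        using sj by (intro inj_onI) (metis surj_image_vimage_eq)
      moreover have "(\<lambda>Z. (\<lambda>v. g *v v) -` Z) ` F \<subseteq> F" using GF[OF g] by auto
      ultimately have "(\<lambda>Z. (\<lambda>v. g *v v) -` Z) ` F = F" using F_fin by (metis endo_inj_surj)
      then have "Z \<in> (\<lambda>Z. (\<lambda>v. g *v v) -` Z) ` F" using Z(1) by simp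
      then obtain Z' where Z': "Z' \<in> F" "Z = (\<lambda>v. g *v v) -` Z'" by blast
      have "Z' = (\<lambda>v. g *v v) ` Z" using Z'(2) sj by (metis surj_image_vimage_eq)
      then have sp: "span Z' = (\<lambda>v. g *v v) ` span Z"
        by (simp add: linear_span_image)
      have "span Z' \<noteq> UNIV"
      proof
        assume U: "span Z' = UNIV"
        have inj: "inj (\<lambda>v. g *v v)" using ginv by (simp add: invertible_left_inverse matrix_left_invertible_injective)
        have "span Z = UNIV"
        proof -
          have "w \<in> span Z" for w
            using U sp inj by (metis UNIV_I imageE injD)
          then show ?thesis by auto
        qed
        then show False using Z by simp
      qed
      then have "span Z' \<in> W" using Z' by (auto simp: W_def)
      moreover have "g *v v \<in> span Z'" using sp Z by auto
      ultimately show "g *v v \<in> \<Union>W" by blast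
    qed
    moreover have "finite W" "W \<noteq> {}" using F_fin Z0 nU by (auto simp: W_def)
    ultimately show False using irred[unfolded strongly_irreducible_def, rule_format, of W] by simp
  qed
  show ?thesis
  proof (rule that[OF F_fin F_ne F_A _ _ spn AEF GF])
    show "0 < measure \<rho> Z" if "Z \<in> F" for Z using that a0 by (simp add: F_def)
    show "measure \<rho> A = 0" if "Z \<in> F" "A \<in> \<A>" "A \<subset> Z" for Z A
      using that rk_strict[of A Z] by (intro small) (auto simp: F_def \<A>r_def)
  qed
qed

end

section \<open>Convolution powers and averages\<close>

lemma sets_invertible: "{g :: real^'n^'n. invertible g} \<in> sets borel"
proof -
  have "open {g :: real^'n^'n. det g \<noteq> 0}"
    by (intro open_Collect_neq continuous_on_det_entries continuous_intros)
  then show ?thesis by (simp add: invertible_det_nz)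
qed

context matrix_walk begin

text \<open>In the family of linear subspaces a minimal cone is a subspace that spans everything,
  hence the whole space; minimality then says that every proper subspace is null.\<close>

lemma subspace_null:
  fixes W :: "(real^'n) set"
  assumes W: "subspace W" "W \<noteq> UNIV"
  shows "measure \<rho> W = 0"
proof -
  interpret walk_family m \<rho> G "{W. subspace W}" dim
  proof
    fix A :: "(real^'n) set" and g :: "real^'n^'n"
    assume A: "A \<in> {W. subspace W}" and g: "invertible g"
    show v: "(\<lambda>v. g *v v) -` A \<in> {W. subspace W}"
      using A by (auto simp: subspace_def matrix_vector_right_distrib matrix_vector_mult_scaleR)
    have "surj (\<lambda>v. g *v v)"
      using g by (simp add: invertible_right_inverse matrix_right_invertible_surjective)
    moreover have "inj (\<lambda>v. g *v v)"
      using g by (simp add: invertible_left_inverse matrix_left_invertible_injective)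
    ultimately show "dim ((\<lambda>v. g *v v) -` A) = dim A"
      by (metis dim_image_eq matrix_vector_mul_linear surj_image_vimage_eq inj_on_subset subset_UNIV)
  next
    fix A B :: "(real^'n) set"
    assume "A \<in> {W. subspace W}" "B \<in> {W. subspace W}" "A \<subset> B"
    then show "dim A < dim B" by (intro dim_psubset) (simp add: span_eq_iff[THEN iffD2])
  qed (auto simp: closed_cone_def closed_subspace subspace_scale subspace_inter)
  obtain F where F: "F \<noteq> {}" "F \<subseteq> {W. subspace W}"
    "\<And>Z A. Z \<in> F \<Longrightarrow> A \<in> {W. subspace W} \<Longrightarrow> A \<subset> Z \<Longrightarrow> measure \<rho> A = 0"
    "\<And>Z. Z \<in> F \<Longrightarrow> span Z = UNIV"
    by (rule minimal_cones) blast
  then obtain Z where "Z \<in> F" by blast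
  moreover from this have "Z = UNIV" using F(2,4) by (metis mem_Collect_eq span_eq_iff subsetD)
  ultimately show ?thesis using F(3)[of Z W] W by auto
qed

lemma AE_mat_vec_nonzero:
  assumes "A \<noteq> (0 :: real^'n^'n)" shows "AE v in \<rho>. A *v v \<noteq> 0"
proof -
  have "subspace {v. A *v v = 0}" by (rule linear_subspace_kernel) simp
  moreover have "{v. A *v v = 0} \<noteq> UNIV"
  proof
    assume "{v. A *v v = 0} = UNIV"
    then have "A *v v = 0 *v v" for v by auto
    then have "A = 0" by (metis matrix_eq)
    then show False using assms by simp
  qed
  ultimately have "measure \<rho> {v. A *v v = 0} = 0" by (rule subspace_null)
  moreover have "{v. A *v v = 0} \<in> sets \<rho>"
    using \<open>subspace {v. A *v v = 0}\<close> by (intro sets_rho_closed closed_subspace)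
  ultimately show ?thesis by (subst (asm) \<rho>.prob_eq_0) auto
qed

section \<open>Laws of products of independent matrices\<close>

definition conv :: "(real^'n^'n) measure \<Rightarrow> (real^'n^'n) measure \<Rightarrow> (real^'n^'n) measure" where
  "conv a b = distr (a \<Otimes>\<^sub>M b) borel (\<lambda>(x, y). x ** y)"

text \<open>New factors enter on the right, next to the vector, because stationarity integrates out
  the innermost factor.\<close>

primrec pw :: "nat \<Rightarrow> (real^'n^'n) measure" where
  "pw 0 = return borel (mat 1)"
| "pw (Suc k) = conv (pw k) m"

lemma sets_conv [simp, measurable_cong]: "sets (conv a b) = sets borel" by (simp add: conv_def)

lemma sets_pw [simp, measurable_cong]: "sets (pw k) = sets borel"
  by (cases k) simp_all

lemma space_pw [simp]: "space (pw k) = UNIV"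
  using sets_eq_imp_space_eq[OF sets_pw] by simp

lemma mult_measurable_pair:
  fixes a b :: "(real^'n^'n) measure"
  assumes "sets a = sets borel" "sets b = sets borel"
  shows "(\<lambda>(x, y). x ** y) \<in> a \<Otimes>\<^sub>M b \<rightarrow>\<^sub>M (borel :: (real^'n^'n) measure)"
proof -
  have "fst \<in> a \<Otimes>\<^sub>M b \<rightarrow>\<^sub>M borel" "snd \<in> a \<Otimes>\<^sub>M b \<rightarrow>\<^sub>M borel"
    using measurable_fst[of a b] measurable_snd[of a b]
    by (simp_all add: measurable_cong_sets[OF refl assms(1)] measurable_cong_sets[OF refl assms(2)])
  then show ?thesis unfolding split_beta by (rule measurable_mat_mat)
qed

lemma prob_pw: "prob_space (pw k)"
proof (induction k)
  case 0 show ?case by (simp add: prob_space_return)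
next
  case (Suc k)
  interpret p: prob_space "pw k" by (rule Suc)
  interpret pair_prob_space "pw k" m ..
  show ?case unfolding pw.simps conv_def
    by (intro prob_space_distr mult_measurable_pair) (simp_all add: sets_m)
qed

lemma nn_integral_conv:
  assumes a: "prob_space a" "sets a = sets borel" and b: "prob_space b" "sets b = sets borel"
    and f [measurable]: "f \<in> borel_measurable borel"
  shows "(\<integral>\<^sup>+z. f z \<partial>conv a b) = (\<integral>\<^sup>+x. \<integral>\<^sup>+y. f (x ** y) \<partial>b \<partial>a)"
proof -
  interpret b: prob_space b by fact
  note [measurable] = mult_measurable_pair[OF a(2) b(2)]
  have [measurable]: "(\<lambda>(x, y). f (x ** y)) \<in> borel_measurable (a \<Otimes>\<^sub>M b)"
    using measurable_compose[OF mult_measurable_pair[OF a(2) b(2)] f] by (simp add: split_beta)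
  show ?thesis unfolding conv_def
    by (subst nn_integral_distr) (auto simp: split_beta b.nn_integral_fst[symmetric])
qed

lemma integral_conv:
  fixes f :: "_ \<Rightarrow> 'b::{banach, second_countable_topology}"
  assumes a: "prob_space a" "sets a = sets borel" and b: "prob_space b" "sets b = sets borel"
    and f: "f \<in> borel_measurable borel" and B: "\<And>x. norm (f x) \<le> B"
  shows "(\<integral>z. f z \<partial>conv a b) = (\<integral>x. (\<integral>y. f (x ** y) \<partial>b) \<partial>a)"
proof -
  interpret a: prob_space a by fact
  interpret b: prob_space b by fact
  interpret pair_prob_space a b ..
  have "(\<lambda>(x, y). f (x ** y)) \<in> borel_measurable (a \<Otimes>\<^sub>M b)"
    using measurable_compose[OF mult_measurable_pair[OF a(2) b(2)] f] by (simp add: split_beta)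
  then have "integrable (a \<Otimes>\<^sub>M b) (\<lambda>(x, y). f (x ** y))"
    by (intro integrable_const_bound[of _ B]) (auto simp: B)
  from integral_fst'[OF this] show ?thesis
    unfolding conv_def by (subst integral_distr[OF mult_measurable_pair[OF a(2) b(2)] f]) (simp add: case_prod_beta')
qed

text \<open>Lets a product of i + k factors be read as b g with b of law \<open>pw i\<close> and an
  independent g of law \<open>pw k\<close>; the induction is associativity of convolution.\<close>

lemma pw_add: "pw (i + k) = conv (pw i) (pw k)"
proof (induction k)
  case 0
  show ?case
  proof (rule measure_eqI)
    fix X assume "X \<in> sets (pw (i + 0))"
    then have [measurable]: "X \<in> sets borel" by simp
    have "emeasure (conv (pw i) (pw 0)) X = (\<integral>\<^sup>+x. \<integral>\<^sup>+y. indicator X (x ** y) \<partial>pw 0 \<partial>pw i)"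
      by (subst nn_integral_conv[OF prob_pw sets_pw prob_pw sets_pw, symmetric]) simp_all
    also have "\<dots> = (\<integral>\<^sup>+x. indicator X x \<partial>pw i)"
    proof (intro nn_integral_cong)
      fix x :: "real^'n^'n"
      have "(\<integral>\<^sup>+y. indicator X (x ** y) \<partial>return borel (mat 1)) = (indicator X (x ** mat 1) :: ennreal)"
        by (rule nn_integral_return) auto
      then show "(\<integral>\<^sup>+y. indicator X (x ** y) \<partial>pw 0) = (indicator X x :: ennreal)" by simp
    qed
    finally show "emeasure (pw (i + 0)) X = emeasure (conv (pw i) (pw 0)) X" by simp
  qed simp
next
  case (Suc k)
  show ?case
  proof (rule measure_eqI)
    fix X assume "X \<in> sets (pw (i + Suc k))"
    then have [measurable]: "X \<in> sets borel" by simp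
    have ind: "emeasure M X = (\<integral>\<^sup>+x. indicator X x \<partial>M)" if "sets M = sets borel" for M
      using that by simp
    have pc: "prob_space (conv (pw i) (pw k))" using prob_pw[of "i + k"] Suc by simp
    interpret m: prob_space m by (rule prob_m)
    have mm: "(\<lambda>z. \<integral>\<^sup>+w. indicator X (z ** w) \<partial>m :: ennreal) \<in> borel_measurable borel"
      by (rule m.borel_measurable_nn_integral) (simp add: split_beta)
    have "emeasure (pw (i + Suc k)) X = (\<integral>\<^sup>+z. \<integral>\<^sup>+w. indicator X (z ** w) \<partial>m \<partial>conv (pw i) (pw k))"
      by (simp add: ind Suc nn_integral_conv[OF pc _ prob_m sets_m] del: nn_integral_indicator)
    also have "\<dots> = (\<integral>\<^sup>+x. \<integral>\<^sup>+y. \<integral>\<^sup>+w. indicator X (x ** y ** w) \<partial>m \<partial>pw k \<partial>pw i)"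
      by (rule nn_integral_conv[OF prob_pw _ prob_pw _ mm]) simp_all
    also have "\<dots> = (\<integral>\<^sup>+x. \<integral>\<^sup>+z. indicator X (x ** z) \<partial>pw (Suc k) \<partial>pw i)"
      by (simp add: nn_integral_conv[OF prob_pw _ prob_m sets_m] matrix_mul_assoc)
    also have "\<dots> = emeasure (conv (pw i) (pw (Suc k))) X"
      by (subst nn_integral_conv[symmetric]) (auto intro: prob_pw simp del: pw.simps)
    finally show "emeasure (pw (i + Suc k)) X = emeasure (conv (pw i) (pw (Suc k))) X" .
  qed simp
qed

lemma pw_1: "pw 1 = m"
proof (rule measure_eqI)
  fix X assume "X \<in> sets (pw 1)"
  then have [measurable]: "X \<in> sets borel" by simp
  have "emeasure (pw 1) X = (\<integral>\<^sup>+x. \<integral>\<^sup>+y. indicator X (x ** y) \<partial>m \<partial>return borel (mat 1))"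
    unfolding One_nat_def pw.simps
    by (subst nn_integral_conv[symmetric]) (auto simp: prob_m sets_m prob_space_return)
  also have "\<dots> = (\<integral>\<^sup>+y. indicator X (mat 1 ** y) \<partial>m)"
    by (rule nn_integral_return) (auto intro!: m.borel_measurable_nn_integral simp: split_beta)
  finally show "emeasure (pw 1) X = emeasure m X" by (simp add: sets_m)
qed (simp add: sets_m)

lemma AE_pw:
  assumes P: "AE g in m. P g" and P1: "P (mat 1)" and mult: "\<And>a b. P a \<Longrightarrow> P b \<Longrightarrow> P (a ** b)"
    and meas: "{g. P g} \<in> sets borel"
  shows "AE g in pw k. P g"
proof (induction k)
  case 0
  show ?case unfolding pw.simps by (subst AE_return) (use P1 meas in \<open>auto simp: pred_def\<close>)
next
  case (Suc k)
  interpret p: prob_space "pw k" by (rule prob_pw)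
  interpret pair_prob_space "pw k" m ..
  have [measurable]: "Measurable.pred borel P" using meas by (simp add: pred_def)
  have "AE p in pw k \<Otimes>\<^sub>M m. P (fst p ** snd p)"
  proof (rule AE_pair_measure)
    show "{x \<in> space (pw k \<Otimes>\<^sub>M m). P (fst x ** snd x)} \<in> sets (pw k \<Otimes>\<^sub>M m)" by measurable
    show "AE x in pw k. AE y in m. P (fst (x, y) ** snd (x, y))"
      using Suc
    proof eventually_elim
      case (elim x)
      show ?case using P by eventually_elim (simp add: mult elim)
    qed
  qed
  then show ?case unfolding pw.simps conv_def
    by (subst AE_distr_iff[OF mult_measurable_pair]) (use meas in \<open>auto simp: sets_m split_beta\<close>)
qed

lemma pw_invertible: "AE g in pw k. invertible g"
  by (rule AE_pw[OF m_inv _ invertible_mult sets_invertible]) (simp_all add: invertible_def)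

section \<open>Averages over the stationary measure and their martingale property\<close>

definition avg :: "(real^'n \<Rightarrow> 'b::euclidean_space) \<Rightarrow> real^'n^'n \<Rightarrow> 'b" where
  "avg f b = (\<integral>v. f (b *v v) \<partial>\<rho>)"

lemma avg_measurable [measurable]: "hom0 f \<Longrightarrow> avg f \<in> borel_measurable borel"
  unfolding avg_def
proof (rule \<rho>.borel_measurable_lebesgue_integral)
  assume "hom0 f"
  note [measurable] = hom0_measurable[OF this]
  show "(\<lambda>(b, v). f (b *v v)) \<in> borel_measurable (borel \<Otimes>\<^sub>M \<rho>)" unfolding split_beta by measurable
qed

lemma integrable_hom0:
  fixes f :: "real^'n \<Rightarrow> 'b::euclidean_space"
  assumes "hom0 f" shows "integrable \<rho> (\<lambda>v. f (b *v v))"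
proof -
  note [measurable] = hom0_measurable[OF assms]
  obtain B where "\<And>v. norm (f v) \<le> B" using hom0_bound[OF assms] by metis
  then show ?thesis by (intro \<rho>.integrable_const_bound[of _ B]) auto
qed

lemma avg_norm_le: 
  assumes "hom0 f" "\<And>v. norm (f v) \<le> B" shows "norm (avg f b) \<le> B"
proof -
  note [measurable] = hom0_measurable[OF assms(1)]
  have "norm (avg f b) \<le> (\<integral>v. norm (f (b *v v)) \<partial>\<rho>)" unfolding avg_def by (rule integral_norm_bound)
  also have "\<dots> \<le> B"
    by (rule \<rho>.integral_le_const[OF integrable_norm[OF integrable_hom0[OF assms(1)]]]) (simp add: assms)
  finally show ?thesis .
qed

lemma avg_comp: "avg (\<lambda>v. f (b *v v)) g = avg f (b ** g)"
  by (simp add: avg_def matrix_vector_mul_assoc)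

lemma avg_scale: "hom0 f \<Longrightarrow> t \<noteq> 0 \<Longrightarrow> avg f (t *\<^sub>R b) = avg f b"
  unfolding avg_def
  by (intro Bochner_Integration.integral_cong refl)
     (metis hom0_scale scaleR_matrix_vector_assoc scaleR_zero_right)

text \<open>The limit \<open>A\<close> may be singular. Its kernel is a proper subspace, hence null,
  so \<open>f\<close> is continuous at \<open>A *v v\<close> for almost every v.\<close>

lemma avg_tendsto:
  assumes f: "hom0 f" and X: "X \<longlonglongrightarrow> A" "A \<noteq> 0"
  shows "(\<lambda>j. avg f (X j)) \<longlonglongrightarrow> avg f A"
proof -
  note [measurable] = hom0_measurable[OF f]
  obtain B where B: "\<And>v. norm (f v) \<le> B" using hom0_bound[OF f] by metis
  show ?thesis unfolding avg_def
  proof (rule integral_dominated_convergence[where w="\<lambda>_. B"])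
    show "AE v in \<rho>. (\<lambda>j. f (X j *v v)) \<longlonglongrightarrow> f (A *v v)"
      using AE_mat_vec_nonzero[OF X(2)]
      by eventually_elim (intro hom0_tendsto[OF f] tendsto_mat_vec X(1) tendsto_const)
  qed (auto simp: B)
qed

lemma integrable_bounded_pw:
  fixes h :: "real^'n^'n \<Rightarrow> 'b::euclidean_space"
  assumes "h \<in> borel_measurable borel" "\<And>b. norm (h b) \<le> B"
  shows "integrable (pw k) h"
proof -
  interpret prob_space "pw k" by (rule prob_pw)
  show ?thesis using assms by (intro integrable_const_bound[of _ B]) auto
qed

lemma stat_vec:
  fixes f :: "real^'n \<Rightarrow> 'b::euclidean_space"
  assumes f: "hom0 f"
  shows "(\<integral>g. avg f g \<partial>m) = avg f (mat 1)"
proof (rule euclidean_eqI)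
  fix i :: 'b assume "i \<in> Basis"
  obtain B where B: "\<And>v. norm (f v) \<le> B" using hom0_bound[OF f] by metis
  have int: "integrable m (avg f)"
    using integrable_bounded_pw[OF avg_measurable[OF f] avg_norm_le[OF f B], of 1] by (simp only: pw_1)
  have fi: "hom0 (\<lambda>v. f v \<bullet> i)" unfolding hom0_def
  proof (intro conjI)
    show "continuous_on (- {0}) (\<lambda>v. f v \<bullet> i)" using f by (intro continuous_intros) (simp add: hom0_def)
    have "bounded ((\<lambda>x. x \<bullet> i) ` range f)"
      using f by (intro bounded_linear_image[OF _ bounded_linear_inner_left]) (simp add: hom0_def)
    then show "bounded (range (\<lambda>v. f v \<bullet> i))" by (simp add: image_image)
  qed (use f in \<open>simp add: hom0_def\<close>)
  have "(\<integral>g. avg f g \<partial>m) \<bullet> i = (\<integral>g. avg (\<lambda>v. f v \<bullet> i) g \<partial>m)"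
  proof -
    have "avg (\<lambda>v. f v \<bullet> i) g = avg f g \<bullet> i" for g
      by (simp add: avg_def integral_inner_left[OF integrable_hom0[OF f]])
    then show ?thesis by (simp add: integral_inner_left[OF int])
  qed
  also have "\<dots> = (\<integral>v. f v \<bullet> i \<partial>\<rho>)" unfolding avg_def by (rule stat_swap[OF fi])
  also have "\<dots> = avg f (mat 1) \<bullet> i"
    using integrable_hom0[OF f, of "mat 1"] by (simp add: avg_def)
  finally show "(\<integral>g. avg f g \<partial>m) \<bullet> i = avg f (mat 1) \<bullet> i" .
qed

text \<open>Integrating out the last factor g of b g leaves the average at b:
  \<open>stat_vec\<close> applies to f composed with b, again a function on lines because b is
  almost surely invertible.\<close>

lemma stat_pw:
  fixes f :: "real^'n \<Rightarrow> 'b::euclidean_space"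
  assumes f: "hom0 f"
  shows "(\<integral>g. avg f g \<partial>pw k) = avg f (mat 1)"
proof (induction k)
  case 0
  show ?case by (simp add: integral_return avg_measurable[OF f])
next
  case (Suc k)
  obtain B where B: "\<And>v. norm (f v) \<le> B" using hom0_bound[OF f] by metis
  have "(\<integral>g. avg f g \<partial>pw (Suc k)) = (\<integral>b. (\<integral>g. avg f (b ** g) \<partial>m) \<partial>pw k)"
    unfolding pw.simps
    by (rule integral_conv[OF prob_pw _ prob_m sets_m avg_measurable[OF f] avg_norm_le[OF f B]]) simp
  also have "\<dots> = (\<integral>b. avg f b \<partial>pw k)"
  proof (rule integral_cong_AE)
    show "AE b in pw k. (\<integral>g. avg f (b ** g) \<partial>m) = avg f b"
      using pw_invertible
    proof eventually_elim
      case (elim b)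
      show ?case using stat_vec[OF hom0_comp_invertible[OF f elim]] by (simp add: avg_comp)
    qed
    show "(\<lambda>b. \<integral>g. avg f (b ** g) \<partial>m) \<in> borel_measurable (pw k)"
      by (rule m.borel_measurable_lebesgue_integral) (use avg_measurable[OF f] in \<open>simp add: split_beta\<close>)
  qed (use avg_measurable[OF f] in simp)
  finally show ?case using Suc by simp
qed

definition energy :: "(real^'n \<Rightarrow> 'b::euclidean_space) \<Rightarrow> nat \<Rightarrow> real" where
  "energy f k = (\<integral>b. (norm (avg f b))\<^sup>2 \<partial>pw k)"

text \<open>Martingale increments are orthogonal, so the energies grow by the mean square increment.\<close>

lemma energy_increment:
  fixes f :: "real^'n \<Rightarrow> 'b::euclidean_space"
  assumes f: "hom0 f"
  shows "(\<integral>b. (\<integral>g. (norm (avg f (b ** g) - avg f b))\<^sup>2 \<partial>pw k) \<partial>pw i) = energy f (i + k) - energy f i"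
proof -
  note [measurable] = avg_measurable[OF f]
  obtain B where B: "\<And>v. norm (f v) \<le> B" using hom0_bound[OF f] by metis
  have Bm: "norm (avg f b) \<le> B" for b by (rule avg_norm_le[OF f B])
  then have B2: "norm ((norm (avg f b))\<^sup>2) \<le> B\<^sup>2" for b by (simp add: power_mono)
  interpret K: prob_space "pw k" by (rule prob_pw)
  interpret I: prob_space "pw i" by (rule prob_pw)
  have sq: "integrable (pw k) (\<lambda>g. (norm (avg f (b ** g)))\<^sup>2)" for b
    by (rule integrable_bounded_pw[OF _ B2]) simp
  have lin: "integrable (pw k) (\<lambda>g. avg f (b ** g))" for b
    by (rule integrable_bounded_pw[OF _ Bm]) simp
  have meas: "(\<lambda>b. \<integral>g. (norm (avg f (b ** g)))\<^sup>2 \<partial>pw k) \<in> borel_measurable borel"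
    by (rule K.borel_measurable_lebesgue_integral) (simp add: split_beta)
  have inner_step: "(\<integral>g. (norm (avg f (b ** g) - avg f b))\<^sup>2 \<partial>pw k)
      = (\<integral>g. (norm (avg f (b ** g)))\<^sup>2 \<partial>pw k) - (norm (avg f b))\<^sup>2" if b: "invertible b" for b
  proof -
    have e: "(norm (x - y))\<^sup>2 = (norm x)\<^sup>2 - 2 * (x \<bullet> y) + (norm y)\<^sup>2" for x y :: 'b
      by (simp add: power2_norm_eq_inner inner_diff_left inner_diff_right inner_commute)
    \<comment> \<open>By the martingale property the mixed term integrates to the squared norm of
      \<open>avg f b\<close>.\<close>
    have "(\<integral>g. avg f (b ** g) \<partial>pw k) = avg f b"
      using stat_pw[OF hom0_comp_invertible[OF f b], of k] by (simp add: avg_comp)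
    then have "(\<integral>g. avg f (b ** g) \<bullet> avg f b \<partial>pw k) = (norm (avg f b))\<^sup>2"
      by (simp add: integral_inner_left[OF lin] power2_norm_eq_inner)
    then show ?thesis unfolding e
      using sq[of b] lin[of b] K.prob_space by simp
  qed
  have "(\<integral>b. (\<integral>g. (norm (avg f (b ** g) - avg f b))\<^sup>2 \<partial>pw k) \<partial>pw i)
     = (\<integral>b. (\<integral>g. (norm (avg f (b ** g)))\<^sup>2 \<partial>pw k) - (norm (avg f b))\<^sup>2 \<partial>pw i)"
  proof (rule integral_cong_AE)
    show "AE b in pw i. (\<integral>g. (norm (avg f (b ** g) - avg f b))\<^sup>2 \<partial>pw k)
      = (\<integral>g. (norm (avg f (b ** g)))\<^sup>2 \<partial>pw k) - (norm (avg f b))\<^sup>2"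
      using pw_invertible[of i] by eventually_elim (rule inner_step)
    show "(\<lambda>b. \<integral>g. (norm (avg f (b ** g) - avg f b))\<^sup>2 \<partial>pw k) \<in> borel_measurable (pw i)"
      by (rule K.borel_measurable_lebesgue_integral) (simp add: split_beta)
  qed (use meas in simp)
  also have "\<dots> = (\<integral>b. (\<integral>g. (norm (avg f (b ** g)))\<^sup>2 \<partial>pw k) \<partial>pw i) - energy f i"
    unfolding energy_def
  proof (rule Bochner_Integration.integral_diff)
    have "norm (\<integral>g. (norm (avg f (b ** g)))\<^sup>2 \<partial>pw k) \<le> B\<^sup>2" for b
      using K.integral_le_const[OF sq, of b "B\<^sup>2"] B2 by (simp add: integral_nonneg_AE)
    then show "integrable (pw i) (\<lambda>b. \<integral>g. (norm (avg f (b ** g)))\<^sup>2 \<partial>pw k)"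
      by (intro integrable_bounded_pw[OF meas]) auto
  qed (rule integrable_bounded_pw[OF _ B2], simp)
  also have "(\<integral>b. (\<integral>g. (norm (avg f (b ** g)))\<^sup>2 \<partial>pw k) \<partial>pw i) = energy f (i + k)"
    unfolding energy_def pw_add
    by (rule integral_conv[OF prob_pw _ prob_pw _ _ B2, symmetric]) simp_all
  finally show ?thesis .
qed

text \<open>The energies increase and are bounded, hence converge. This mean square statement takes
  the place of almost sure martingale convergence.\<close>

lemma energy_increment_tendsto:
  fixes f :: "real^'n \<Rightarrow> 'b::euclidean_space"
  assumes f: "hom0 f"
  shows "(\<lambda>i. energy f (i + k) - energy f i) \<longlonglongrightarrow> 0"
proof -
  note [measurable] = avg_measurable[OF f]
  obtain B where B: "\<And>v. norm (f v) \<le> B" using hom0_bound[OF f] by metis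
  have B2: "norm ((norm (avg f b))\<^sup>2) \<le> B\<^sup>2" for b by (simp add: power_mono avg_norm_le[OF f B])
  have "energy f i \<le> energy f (Suc i)" for i
  proof -
    have "0 \<le> energy f (i + 1) - energy f i"
      unfolding energy_increment[OF f, symmetric] by (intro integral_nonneg_AE AE_I2) simp
    then show ?thesis by simp
  qed
  then have "incseq (energy f)" by (rule incseq_SucI)
  moreover have "energy f i \<le> B\<^sup>2" for i
  proof -
    interpret prob_space "pw i" by (rule prob_pw)
    show ?thesis unfolding energy_def using B2
      by (intro integral_le_const integrable_bounded_pw[OF _ B2]) auto
  qed
  ultimately obtain L where L: "energy f \<longlonglongrightarrow> L" by (metis incseq_convergent)
  have "(\<lambda>i. energy f (i + k) - energy f i) \<longlonglongrightarrow> L - L"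
    by (intro tendsto_diff L LIMSEQ_ignore_initial_segment)
  then show ?thesis by simp
qed

end

section \<open>Contraction\<close>

text \<open>Places lines in a Euclidean space, where they can be averaged. Nonzero vectors go to the
  unit sphere of the Frobenius norm, and 0 goes to 0.\<close>

definition line_proj :: "real^'n \<Rightarrow> real^'n^'n" where
  "line_proj v = (1 / (v \<bullet> v)) *\<^sub>R (\<chi> i j. v $ i * v $ j)"

text \<open>For nonzero vectors this is the squared cosine of the angle between the lines, which is
  1 exactly when they coincide.\<close>

lemma inner_line_proj: "line_proj v \<bullet> line_proj w = (v \<bullet> w)\<^sup>2 / ((v \<bullet> v) * (w \<bullet> w))"
proof -
  have "(\<chi> i j. v $ i * v $ j) \<bullet> (\<chi> i j. w $ i * w $ j) = (v \<bullet> w)\<^sup>2"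
    by (simp add: inner_vec_def power2_eq_square sum_product ac_simps)
  then show ?thesis by (simp add: line_proj_def)
qed

lemma norm_line_proj_le: "norm (line_proj v) \<le> 1"
proof -
  have "(norm (line_proj v))\<^sup>2 \<le> 1"
    unfolding power2_norm_eq_inner inner_line_proj by (simp add: power2_eq_square)
  then show ?thesis by (simp add: power2_le_imp_le abs_square_le_1[symmetric] abs_le_square_iff)
qed

lemma line_proj_scale: "t \<noteq> 0 \<Longrightarrow> line_proj (t *\<^sub>R v) = line_proj v"
  by (simp add: line_proj_def vec_eq_iff power2_eq_square)

lemma hom0_line_proj: "hom0 line_proj"
  unfolding hom0_def
proof (intro conjI allI impI)
  show "continuous_on (-{0}) (line_proj :: real^'n \<Rightarrow> _)"
    unfolding line_proj_def by (intro continuous_intros) auto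
  show "bounded (range (line_proj :: real^'n \<Rightarrow> _))"
    unfolding bounded_iff using norm_line_proj_le by blast
qed (simp add: line_proj_scale)

lemma cauchy_schwarz_eq_span:
  fixes z w :: "'a::real_inner"
  assumes "z \<noteq> 0" "(z \<bullet> w)\<^sup>2 = (z \<bullet> z) * (w \<bullet> w)" shows "w \<in> span {z}"
proof -
  have "z \<bullet> z \<noteq> 0" using assms by simp
  define t where "t = (z \<bullet> w) / (z \<bullet> z)"
  have "(w - t *\<^sub>R z) \<bullet> (w - t *\<^sub>R z) = w \<bullet> w - (z \<bullet> w)\<^sup>2 / (z \<bullet> z)"
    using \<open>z \<bullet> z \<noteq> 0\<close> by (simp add: t_def inner_diff_left inner_diff_right inner_commute power2_eq_square field_simps)
  also have "\<dots> = 0" using assms \<open>z \<bullet> z \<noteq> 0\<close> by simp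
  finally have "w = t *\<^sub>R z" by simp
  then show ?thesis by (simp add: span_scale span_base)
qed

lemma invertible_nonzero: "invertible (b :: real^'n^'n) \<Longrightarrow> b \<noteq> 0"
  using invertible_mult_nonzero[of b "axis undefined 1"] by (auto simp: axis_eq_0_iff)

lemma mult_invertible_nonzero:
  fixes A :: "real^'n^'n"
  assumes "A \<noteq> 0" "invertible h" shows "A ** h \<noteq> 0"
proof
  assume "A ** h = 0"
  moreover obtain h' where "h ** h' = mat 1" using assms by (auto simp: invertible_def)
  ultimately have "A = 0 ** h'" by (metis matrix_mul_assoc matrix_mul_rid)
  then show False using assms by simp
qed

context matrix_walk begin

lemma span_invariant:
  assumes inv: "\<And>g v. g \<in> G \<Longrightarrow> v \<in> S \<Longrightarrow> g *v v \<in> S" and "x \<in> S" "x \<noteq> 0"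
  shows "span S = UNIV"
proof (rule ccontr)
  assume "span S \<noteq> UNIV"
  moreover have "span S \<noteq> {0}" using assms(2,3) span_base by blast
  moreover have "(\<lambda>v. g *v v) ` span S \<subseteq> span S" if "g \<in> G" for g
  proof -
    have "(\<lambda>v. g *v v) ` span S = span ((\<lambda>v. g *v v) ` S)" by (simp add: linear_span_image)
    also have "\<dots> \<subseteq> span S" using inv[OF that] by (intro span_mono) auto
    finally show ?thesis .
  qed
  ultimately show False using irred[unfolded strongly_irreducible_def, rule_format, of "{span S}"] by auto
qed

text \<open>A unit vector is an average of vectors of norm at most 1 only if almost all of them
  equal it. So almost every \<open>A *v v\<close> lies on the line of \<open>z\<close>, and the
  subspace of all such v, having mass 1, cannot be proper.\<close>

lemma avg_line_proj_eq_imp: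
  assumes A: "A \<noteq> 0" and z: "z \<noteq> 0" and eq: "avg line_proj A = line_proj z"
  shows "A *v v \<in> span {z}"
proof -
  have int: "integrable \<rho> (\<lambda>v. line_proj (A *v v))" by (rule integrable_hom0[OF hom0_line_proj])
  have z1: "line_proj z \<bullet> line_proj z = 1" using z by (simp add: inner_line_proj power2_eq_square)
  have le: "line_proj (A *v v) \<bullet> line_proj z \<le> 1" for v
  proof -
    have "line_proj (A *v v) \<bullet> line_proj z \<le> norm (line_proj (A *v v)) * norm (line_proj z)"
      by (rule norm_cauchy_schwarz)
    also have "\<dots> \<le> 1 * 1" by (intro mult_mono norm_line_proj_le) auto
    finally show ?thesis by simp
  qed
  have inti: "integrable \<rho> (\<lambda>v. line_proj (A *v v) \<bullet> line_proj z)"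
    by (rule integrable_inner_left) (rule int)
  have "(\<integral>v. line_proj (A *v v) \<bullet> line_proj z \<partial>\<rho>) = 1"
    using eq z1 int by (simp add: avg_def)
  then have "(\<integral>v. 1 - line_proj (A *v v) \<bullet> line_proj z \<partial>\<rho>) = 0"
    using inti \<rho>.prob_space by simp
  then have "AE v in \<rho>. 1 - line_proj (A *v v) \<bullet> line_proj z = 0"
    by (subst (asm) integral_nonneg_eq_0_iff_AE) (use inti le in auto)
  then have "AE v in \<rho>. A *v v \<in> span {z}"
    using AE_mat_vec_nonzero[OF A]
  proof eventually_elim
    case (elim v)
    have nz: "((A *v v) \<bullet> (A *v v)) * (z \<bullet> z) \<noteq> 0" using z elim(2) by simp
    have "((A *v v) \<bullet> z)\<^sup>2 / (((A *v v) \<bullet> (A *v v)) * (z \<bullet> z)) = 1"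
      using elim(1) unfolding inner_line_proj by linarith
    then have "((A *v v) \<bullet> z)\<^sup>2 = ((A *v v) \<bullet> (A *v v)) * (z \<bullet> z)"
      unfolding nonzero_divide_eq_eq[OF nz] by linarith
    then have "(z \<bullet> (A *v v))\<^sup>2 = (z \<bullet> z) * ((A *v v) \<bullet> (A *v v))"
      by (simp add: inner_commute mult.commute)
    then show ?case by (rule cauchy_schwarz_eq_span[OF z])
  qed
  then have "AE v in \<rho>. v \<in> (\<lambda>v. A *v v) -` span {z}" by simp
  moreover have sub: "subspace ((\<lambda>v. A *v v) -` span {z})"
    using subspace_span[of "{z}"] by (auto simp: subspace_def matrix_vector_right_distrib matrix_vector_mult_scaleR)
  ultimately have "measure \<rho> ((\<lambda>v. A *v v) -` span {z}) = 1"
    by (subst \<rho>.prob_eq_1) (auto simp: closed_subspace)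
  then have "(\<lambda>v. A *v v) -` span {z} = UNIV" using subspace_null[OF sub] by force
  then show ?thesis by blast
qed

text \<open>Invariance allows \<open>A\<close> to be followed by \<open>\<gamma>\<close> and powers
  of g; after rescaling, these products tend to \<open>P\<close>, whose image is a line. The average
  at \<open>P\<close> is the projection onto that line, and it equals the average at
  \<open>A\<close>.\<close>

lemma rank_one_limit:
  assumes prox: "\<exists>g\<in>G. proximal g" and A: "A \<noteq> 0"
    and inv: "\<And>g. g \<in> G \<Longrightarrow> avg line_proj (A ** g) = avg line_proj A"
  obtains z where "z \<noteq> 0" "\<And>v. A *v v \<in> span {z}"
proof -
  obtain g where g: "g \<in> G" "proximal g" using prox by blast
  obtain c :: real and R :: "real^'n^'n" and x :: "real^'n" where
    R: "c \<noteq> 0" "(\<lambda>j. (1 / c ^ j) *\<^sub>R matpow g j) \<longlonglongrightarrow> R" "R \<noteq> 0" "\<And>v. R *v v \<in> span {x}"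
    using proximal_powers_limit[OF g(2) G_inv[OF g(1)]] by blast
  have x0: "x \<noteq> 0"
  proof
    assume "x = 0"
    then have "R *v v = 0 *v v" for v using R(4)[of v] by simp
    then show False using R(3) by (metis matrix_eq)
  qed
  \<comment> \<open>\<open>A\<close> may kill the attracting direction \<open>x\<close>; since the
    orbit of \<open>x\<close> spans, some translate of it escapes the kernel.\<close>
  have sp: "span ((\<lambda>\<gamma>. \<gamma> *v x) ` G) = UNIV"
  proof (rule span_invariant)
    show "g *v x \<in> (\<lambda>\<gamma>. \<gamma> *v x) ` G" using g by blast
    show "g *v x \<noteq> 0" using x0 G_inv[OF g(1)] invertible_mult_nonzero by blast
    show "h *v v \<in> (\<lambda>\<gamma>. \<gamma> *v x) ` G" if "h \<in> G" "v \<in> (\<lambda>\<gamma>. \<gamma> *v x) ` G" for h v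
      using that G_mult by (auto simp: matrix_vector_mul_assoc)
  qed
  have "\<exists>\<gamma>\<in>G. A *v (\<gamma> *v x) \<noteq> 0"
  proof (rule ccontr)
    assume no: "\<not> ?thesis"
    have "A *v v = 0" if "v \<in> span ((\<lambda>\<gamma>. \<gamma> *v x) ` G)" for v
      using that by (rule linear_eq_0_on_span[rotated 2]) (use no in auto)
    then have "A *v v = 0 *v v" for v using sp by auto
    then show False using A by (metis matrix_eq)
  qed
  then obtain \<gamma> where \<gamma>: "\<gamma> \<in> G" "A *v (\<gamma> *v x) \<noteq> 0" by blast
  define z where "z = A *v (\<gamma> *v x)"
  define P where "P = A ** \<gamma> ** R"
  \<comment> \<open>Powers start at 1, since the identity need not belong to
    \<open>G\<close>.\<close>
  have pow: "matpow g (Suc j) \<in> G" for j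
  proof (induction j)
    case (Suc j)
    then show ?case using G_mult[OF g(1)] by (simp only: matpow.simps(2)[of g "Suc j"])
  qed (use g in simp)
  have Pv: "P *v v \<in> span {z}" for v
  proof -
    obtain t where "R *v v = t *\<^sub>R x" using R(4)[of v] by (auto simp: span_singleton)
    then have "P *v v = t *\<^sub>R z" by (simp add: P_def z_def matrix_vector_mul_assoc[symmetric] matrix_vector_mult_scaleR)
    then show ?thesis by (simp add: span_scale span_base)
  qed
  have "P \<noteq> 0"
  proof
    assume P0: "P = 0"
    obtain w where w: "R *v w \<noteq> 0" using R(3) by (metis matrix_eq matrix_vector_mult_0)
    obtain t where t: "R *v w = t *\<^sub>R x" using R(4)[of w] by (auto simp: span_singleton)
    then have "P *v w = t *\<^sub>R z" by (simp add: P_def z_def matrix_vector_mul_assoc[symmetric] matrix_vector_mult_scaleR)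
    then show False using P0 w t \<gamma>(2) by (auto simp: z_def)
  qed
  have "(\<lambda>j. A ** \<gamma> ** ((1 / c ^ Suc j) *\<^sub>R matpow g (Suc j))) \<longlonglongrightarrow> P"
    unfolding P_def by (rule tendsto_mat_mat[OF tendsto_const LIMSEQ_Suc[OF R(2)]])
  from avg_tendsto[OF hom0_line_proj this \<open>P \<noteq> 0\<close>]
  have "(\<lambda>j. avg line_proj (A ** \<gamma> ** ((1 / c ^ Suc j) *\<^sub>R matpow g (Suc j)))) \<longlonglongrightarrow> avg line_proj P" .
  moreover have "avg line_proj (A ** \<gamma> ** ((1 / c ^ Suc j) *\<^sub>R matpow g (Suc j))) = avg line_proj A" for j
  proof -
    have "A ** \<gamma> ** ((1 / c ^ Suc j) *\<^sub>R matpow g (Suc j)) = (1 / c ^ Suc j) *\<^sub>R (A ** (\<gamma> ** matpow g (Suc j)))"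
      by (simp only: matrix_scalar_ac scalar_matrix_assoc[symmetric] matrix_mul_assoc)
    then show ?thesis using inv[OF G_mult[OF \<gamma>(1) pow]] R(1) avg_scale[OF hom0_line_proj] by simp
  qed
  ultimately have "avg line_proj P = avg line_proj A" by (simp add: LIMSEQ_const_iff)
  moreover have "avg line_proj P = line_proj z"
  proof -
    have "avg line_proj P = (\<integral>v. line_proj z \<partial>\<rho>)" unfolding avg_def
    proof (rule integral_cong_AE)
      show "AE v in \<rho>. line_proj (P *v v) = line_proj z"
        using AE_mat_vec_nonzero[OF \<open>P \<noteq> 0\<close>]
      proof eventually_elim
        case (elim v)
        obtain t where t: "P *v v = t *\<^sub>R z" using Pv[of v] by (auto simp: span_singleton)
        with elim have "t \<noteq> 0" by auto
        then show ?case by (simp add: t line_proj_scale)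
      qed
    qed (use integrable_hom0[OF hom0_line_proj, of P] in auto)
    then show ?thesis using \<rho>.prob_space by simp
  qed
  ultimately have "avg line_proj A = line_proj z" by simp
  then have "A *v v \<in> span {z}" for v
    using avg_line_proj_eq_imp[OF A, of z] \<gamma>(2) by (simp add: z_def)
  then show ?thesis using that \<gamma>(2) unfolding z_def by blast
qed

text \<open>The invertible matrices whose neighbourhoods are all charged by some \<open>pw k\<close>
  form a closed subsemigroup containing the support. For a product, neighbourhoods V and W charged
  by k and l factors multiply into U, so k + l factors charge U.\<close>

lemma G_charged:
  assumes g: "g \<in> G" and U: "open U" "g \<in> U"
  shows "\<exists>k. measure (pw k) U > 0"
proof -
  define S where "S = {g. invertible g \<and> (\<forall>U. open U \<longrightarrow> g \<in> U \<longrightarrow> (\<exists>k. measure (pw k) U > 0))}"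
  have "G \<subseteq> S"
  proof (rule G_least)
    show "invertible g" if "g \<in> S" for g using that by (simp add: S_def)
    show "g \<in> S" if X: "\<And>j::nat. X j \<in> S" "X \<longlonglongrightarrow> g" and g: "invertible g" for X g
    proof -
      have "\<exists>k. measure (pw k) U > 0" if U: "open U" "g \<in> U" for U
      proof -
        have "eventually (\<lambda>j. X j \<in> U) sequentially" using X(2) U by (rule topological_tendstoD)
        then obtain j where "X j \<in> U" by (auto simp: eventually_sequentially)
        then show ?thesis using X(1)[of j] U by (auto simp: S_def)
      qed
      then show ?thesis using g by (simp add: S_def)
    qed
    show "g \<in> S" if "invertible g" "\<And>U. open U \<Longrightarrow> g \<in> U \<Longrightarrow> measure m U > 0" for g
      using that pw_1 unfolding S_def by (auto intro!: exI[of _ 1])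
    show "a ** b \<in> S" if a: "a \<in> S" and b: "b \<in> S" for a b
    proof -
      have "\<exists>k. measure (pw k) U > 0" if U: "open U" "a ** b \<in> U" for U
      proof -
        have o: "open ((\<lambda>p. fst p ** snd p) -` U)"
        proof (rule open_vimage[OF U(1)])
          show "continuous_on UNIV (\<lambda>p. fst p ** snd p :: real^'n^'n)"
            unfolding matrix_matrix_mult_def by (intro continuous_intros)
        qed
        have mem: "(a, b) \<in> (\<lambda>p. fst p ** snd p) -` U" using U by simp
        obtain V W where VW: "open V" "open W" "(a, b) \<in> V \<times> W"
          "V \<times> W \<subseteq> (\<lambda>p. fst p ** snd p) -` U"
          by (rule open_prod_elim[OF o mem]) (rule that; assumption)
        obtain k l where kl: "measure (pw k) V > 0" "measure (pw l) W > 0"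
          using a b VW unfolding S_def by blast
        interpret k: prob_space "pw k" by (rule prob_pw)
        interpret l: prob_space "pw l" by (rule prob_pw)
        interpret pair_prob_space "pw k" "pw l" ..
        have "emeasure (pw k \<Otimes>\<^sub>M pw l) (V \<times> W) = emeasure (pw k) V * emeasure (pw l) W"
          using VW by (intro l.emeasure_pair_measure_Times) auto
        then have "measure (pw k \<Otimes>\<^sub>M pw l) (V \<times> W) = measure (pw k) V * measure (pw l) W"
          by (simp add: measure_def enn2real_mult)
        then have "0 < measure (pw k \<Otimes>\<^sub>M pw l) (V \<times> W)" using kl by simp
        also have "\<dots> \<le> measure (pw k \<Otimes>\<^sub>M pw l) ((\<lambda>(x, y). x ** y) -` U \<inter> space (pw k \<Otimes>\<^sub>M pw l))"
          using VW U(1) by (intro finite_measure_mono measurable_sets[OF mult_measurable_pair])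
             (auto simp: space_pair_measure split_beta)
        also have "\<dots> = measure (pw (k + l)) U"
          unfolding pw_add conv_def using U(1) by (subst measure_distr) (auto intro: mult_measurable_pair)
        finally show ?thesis by blast
      qed
      then show ?thesis using a b by (simp add: S_def invertible_mult)
    qed
  qed
  then show ?thesis using assms by (auto simp: S_def)
qed

text \<open>Under \<open>pw n\<close> the mean of \<open>avg q\<close> keeps its initial value for
  every n, while the summed mean square increments tend to 0; for large n this is incompatible with
  almost every b failing. One b serves all k \<le> j, so that a limit over j handles every
  k.\<close>

lemma typical_matrix:
  fixes f :: "real^'n \<Rightarrow> 'b::euclidean_space" and q :: "real^'n \<Rightarrow> real"
  assumes f: "hom0 f" and q: "hom0 q" "\<And>v. q v \<le> 1" and pos: "avg q (mat 1) > 0"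
    and P: "\<And>n. AE b in pw n. P b"
  shows "\<exists>b. P b \<and> avg q b \<ge> avg q (mat 1) / 2 \<and>
     (\<forall>k\<le>j. (\<integral>g. (norm (avg f (b ** g) - avg f b))\<^sup>2 \<partial>pw k) \<le> 1 / real (Suc j))"
proof -
  note [measurable] = avg_measurable[OF f] avg_measurable[OF q(1)]
  obtain B where B: "\<And>v. norm (f v) \<le> B" using hom0_bound[OF f] by metis
  define c0 where "c0 = avg q (mat 1)"
  define D where "D k b = (\<integral>g. (norm (avg f (b ** g) - avg f b))\<^sup>2 \<partial>pw k)" for k b
  have D0: "D k b \<ge> 0" for k b unfolding D_def by (intro integral_nonneg_AE AE_I2) simp
  have Dm [measurable]: "D k \<in> borel_measurable borel" for k
  proof -
    interpret prob_space "pw k" by (rule prob_pw)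
    show ?thesis unfolding D_def by (rule borel_measurable_lebesgue_integral) (simp add: split_beta)
  qed
  have DB: "\<bar>D k b\<bar> \<le> (B + B)\<^sup>2" for k b
  proof -
    interpret prob_space "pw k" by (rule prob_pw)
    have 1: "\<bar>(norm (avg f (b ** g) - avg f b))\<^sup>2\<bar> \<le> (B + B)\<^sup>2" for g
    proof -
      have "norm (avg f (b ** g) - avg f b) \<le> B + B"
        by (rule order_trans[OF norm_triangle_ineq4 add_mono]; rule avg_norm_le[OF f B])
      then show ?thesis unfolding abs_power2 by (rule power_mono) simp
    qed
    have "D k b \<le> (B + B)\<^sup>2" unfolding D_def
      using 1 by (intro integral_le_const integrable_bounded_pw[of _ "(B + B)\<^sup>2"]) auto
    then show ?thesis using D0 by simp
  qed
  define U where "U b = (\<Sum>k\<le>j. D k b)" for b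
  have Dint: "integrable (pw n) (D k)" for n k by (rule integrable_bounded_pw[of _ "(B + B)\<^sup>2"]) (use DB in \<open>simp_all only: real_norm_def Dm\<close>)
  have "(\<lambda>n. \<integral>b. U b \<partial>pw n) \<longlonglongrightarrow> (\<Sum>k\<le>j. 0)"
    unfolding U_def Bochner_Integration.integral_sum[OF Dint]
    unfolding D_def energy_increment[OF f]
    by (intro tendsto_sum energy_increment_tendsto[OF f])
  \<comment> \<open>The bound makes \<open>real (Suc j)\<close> times the mean of \<open>U\<close>
    less than \<open>c0 / 2\<close>.\<close>
  then have "eventually (\<lambda>n. (\<integral>b. U b \<partial>pw n) < c0 / 2 / real (Suc j)) sequentially"
    by (rule order_tendstoD) (use pos in \<open>simp add: c0_def\<close>)
  then obtain n where n: "(\<integral>b. U b \<partial>pw n) < c0 / 2 / real (Suc j)" by (auto simp: eventually_sequentially)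
  interpret prob_space "pw n" by (rule prob_pw)
  have q1: "avg q b \<le> 1" for b unfolding avg_def
    using q(2) by (intro \<rho>.integral_le_const integrable_hom0[OF q(1)]) auto
  obtain Bq where Bq: "\<And>v. norm (q v) \<le> Bq" using hom0_bound[OF q(1)] by metis
  \<comment> \<open>The first alternative implies the second: nonnegativity of \<open>U b\<close>
    gives the lower bound on \<open>avg q b\<close>, and \<open>avg q b \<le> 1\<close> forces
    \<open>real (Suc j) * U b < 1\<close>.\<close>
  have "\<exists>b. P b \<and> \<not> avg q b < c0 / 2 + real (Suc j) * U b \<or> (P b \<and> avg q b \<ge> c0/2 \<and> U b \<le> 1 / real (Suc j))"
  proof (rule ccontr)
    assume no: "\<not> ?thesis"
    have "AE b in pw n. avg q b \<le> c0 / 2 + real (Suc j) * U b"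
      using P[of n] by eventually_elim (use no in \<open>auto simp: not_le less_imp_le\<close>)
    then have "(\<integral>b. avg q b \<partial>pw n) \<le> (\<integral>b. c0 / 2 + real (Suc j) * U b \<partial>pw n)"
      using Dint by (intro integral_mono_AE integrable_bounded_pw[OF _ avg_norm_le[OF q(1) Bq]])
        (auto simp: U_def)
    also have "\<dots> = c0 / 2 + real (Suc j) * (\<integral>b. U b \<partial>pw n)"
      using Dint prob_space unfolding U_def by simp
    also have "\<dots> < c0" using n by (simp add: field_simps)
    finally show False using stat_pw[OF q(1), of n] by (simp add: c0_def)
  qed
  moreover have "U b \<ge> 0" for b unfolding U_def by (intro sum_nonneg D0)
  ultimately obtain b where b: "P b" "avg q b \<ge> c0 / 2" "U b \<le> 1 / real (Suc j)"
  proof -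
    assume *: "\<And>b. P b \<Longrightarrow> c0 / 2 \<le> avg q b \<Longrightarrow> U b \<le> 1 / real (Suc j) \<Longrightarrow> thesis" and
      ex: "\<exists>b. P b \<and> \<not> avg q b < c0 / 2 + real (Suc j) * U b \<or> (P b \<and> avg q b \<ge> c0/2 \<and> U b \<le> 1 / real (Suc j))"
      and U0: "\<And>b. 0 \<le> U b"
    from ex obtain b where "P b" and b: "\<not> avg q b < c0 / 2 + real (Suc j) * U b \<or> (avg q b \<ge> c0/2 \<and> U b \<le> 1 / real (Suc j))"
      by blast
    show thesis
    proof (rule *[OF \<open>P b\<close>])
      have "0 \<le> real (Suc j) * U b" using U0 by simp
      then show "c0 / 2 \<le> avg q b" using b by linarith
      show "U b \<le> 1 / real (Suc j)"
      proof (rule ccontr)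
        assume n: "\<not> ?thesis"
        then have "real (Suc j) * U b > 1" by (simp add: field_simps not_le)
        moreover have "c0 / 2 + real (Suc j) * U b \<le> 1" using b n q1[of b] by linarith
        ultimately show False using pos by (simp add: c0_def)
      qed
    qed
  qed
  have "D k b \<le> 1 / real (Suc j)" if "k \<le> j" for k
  proof -
    have "D k b \<le> U b" unfolding U_def using that by (intro member_le_sum) (auto simp: D0)
    then show ?thesis using b(3) by simp
  qed
  then show ?thesis using b unfolding c0_def D_def by blast
qed

text \<open>If the mean distance to \<open>N\<close> were positive, typical products would keep at
  least half of it, and so would their limit \<open>A\<close>. But \<open>A\<close> has rank one and
  does not vanish on the spanning set \<open>N\<close>, so its image is a line inside
  \<open>N\<close> and the mean distance there is 0.\<close>

lemma attracting_cone:
  assumes prox: "\<exists>g\<in>G. proximal g"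
    and N: "closed_cone N" "span N = UNIV"
    and Ninv: "AE g in m. \<forall>v\<in>N. g *v v \<in> N"
  shows "measure \<rho> N = 1"
proof -
  have ne: "N \<noteq> {}" using N(2) by (metis UNIV_not_singleton span_empty)
  define q where "q = cdist N"
  have q: "hom0 q" "\<And>v. q v \<le> 1" "\<And>v. q v \<ge> 0"
    using hom0_cdist[OF N(1)] cdist_bounds[OF N(1)] by (simp_all add: q_def)
  have clN: "closed N" using N(1) by (simp add: closed_cone_def)
  define P where "P b \<longleftrightarrow> invertible b \<and> (\<forall>v\<in>N. b *v v \<in> N)" for b :: "real^'n^'n"
  have P_pw: "AE b in pw n. P b" for n
  proof (rule AE_pw)
    show "AE g in m. P g" using m_inv Ninv by eventually_elim (simp add: P_def)
    show "P (mat 1)" by (auto simp: P_def invertible_def)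
    show "P (a ** b)" if "P a" "P b" for a b
      using that by (auto simp: P_def invertible_mult matrix_vector_mul_assoc[symmetric])
    have "closed (\<Inter>v\<in>N. (\<lambda>b. b *v v) -` N)"
    proof (intro closed_INT ballI closed_vimage clN)
      fix v :: "real^'n"
      show "continuous_on UNIV (\<lambda>b :: real^'n^'n. b *v v)"
        unfolding matrix_vector_mult_def by (intro continuous_intros)
    qed
    moreover have "{b. P b} = {b. invertible b} \<inter> (\<Inter>v\<in>N. (\<lambda>b. b *v v) -` N)" by (auto simp: P_def)
    ultimately show "{b. P b} \<in> sets borel" using sets_invertible by auto
  qed
  have "\<not> avg q (mat 1) > 0"
  proof
    assume pos: "avg q (mat 1) > 0"
    define f :: "real^'n \<Rightarrow> real^'n^'n" where "f = line_proj"
    have f: "hom0 f" unfolding f_def by (rule hom0_line_proj)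
    note [measurable] = avg_measurable[OF f]
    have diff: "(norm (avg f B - avg f C))\<^sup>2 \<le> 2\<^sup>2" for B C
    proof -
      have "norm (avg f B) \<le> 1" for B by (rule avg_norm_le[OF f]) (simp add: f_def norm_line_proj_le)
      then have "norm (avg f B - avg f C) \<le> 1 + 1"
        by (intro order_trans[OF norm_triangle_ineq4 add_mono])
      then show ?thesis by (intro power_mono) auto
    qed
    have "\<forall>j. \<exists>b. P b \<and> avg q b \<ge> avg q (mat 1) / 2 \<and>
       (\<forall>k\<le>j. (\<integral>g. (norm (avg f (b ** g) - avg f b))\<^sup>2 \<partial>pw k) \<le> 1 / real (Suc j))"
      by (intro allI typical_matrix f q(1) q(2) pos P_pw)
    then obtain b where b: "\<And>j. P (b j)" "\<And>j. avg q (b j) \<ge> avg q (mat 1) / 2"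
       "\<And>j k. k \<le> j \<Longrightarrow> (\<integral>g. (norm (avg f (b j ** g) - avg f (b j)))\<^sup>2 \<partial>pw k) \<le> 1 / real (Suc j)"
      by metis
    have bnz: "b j \<noteq> 0" for j
    proof
      assume "b j = 0"
      then show False using b(1)[of j] invertible_nonzero by (auto simp: P_def)
    qed
    \<comment> \<open>Normalising moves the matrices to a compact sphere without changing any
      average.\<close>
    define X where "X j = (1 / norm (b j)) *\<^sub>R b j" for j
    have "\<forall>j. X j \<in> sphere 0 1" using bnz by (simp add: X_def)
    then obtain A s where A: "A \<in> sphere 0 1" and s: "strict_mono (s :: nat \<Rightarrow> nat)" "(X \<circ> s) \<longlonglongrightarrow> A"
      using compact_sphere[of "0 :: real^'n^'n" 1, unfolded compact_def] by metis
    have A0: "A \<noteq> 0" using A by auto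
    have Xlim: "(\<lambda>j. X (s j)) \<longlonglongrightarrow> A" using s(2) by (simp add: o_def)
    have avgX: "avg h (X j ** g) = avg h (b j ** g)" if "hom0 h" for h :: "real^'n \<Rightarrow> 'c::euclidean_space" and j g
    proof -
      have "X j ** g = (1 / norm (b j)) *\<^sub>R (b j ** g)"
        unfolding X_def by (simp add: scalar_matrix_assoc)
      then show ?thesis using avg_scale[OF that, of "1 / norm (b j)" "b j ** g"] bnz by simp
    qed
    have avgX1: "avg h (X j) = avg h (b j)" if "hom0 h" for h :: "real^'n \<Rightarrow> 'c::euclidean_space" and j
      using avgX[OF that, of j "mat 1"] by simp
    have inv: "avg f (A ** g) = avg f A" if g: "g \<in> G" for g
    proof -
      \<comment> \<open>In the limit the mean square increment over k further factors is 0, for each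
        k separately.\<close>
      have AEk: "AE h in pw k. avg f (A ** h) = avg f A" for k
      proof -
        have "(\<lambda>j. \<integral>h. (norm (avg f (X (s j) ** h) - avg f (X (s j))))\<^sup>2 \<partial>pw k)
           \<longlonglongrightarrow> (\<integral>h. (norm (avg f (A ** h) - avg f A))\<^sup>2 \<partial>pw k)"
        proof (rule integral_dominated_convergence[where w="\<lambda>_. 2\<^sup>2"])
          show "AE h in pw k. (\<lambda>j. (norm (avg f (X (s j) ** h) - avg f (X (s j))))\<^sup>2)
             \<longlonglongrightarrow> (norm (avg f (A ** h) - avg f A))\<^sup>2"
            using pw_invertible[of k]
          proof eventually_elim
            case (elim h)
            have "A ** h \<noteq> 0" using A0 elim by (rule mult_invertible_nonzero)
            then show ?case
              by (intro tendsto_intros avg_tendsto[OF f] tendsto_mat_mat Xlim A0)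
          qed
          show "AE h in pw k. norm ((norm (avg f (X (s j) ** h) - avg f (X (s j))))\<^sup>2) \<le> 2\<^sup>2" for j
            using diff by simp
          show "integrable (pw k) (\<lambda>_. 2\<^sup>2 :: real)" by (rule integrable_bounded_pw[of _ "2\<^sup>2"]) auto
        qed simp_all
        moreover have "(\<lambda>j. \<integral>h. (norm (avg f (X (s j) ** h) - avg f (X (s j))))\<^sup>2 \<partial>pw k) \<longlonglongrightarrow> 0"
        proof (rule tendsto_sandwich[OF _ _ tendsto_const])
          show "(\<lambda>j. 1 / real (Suc (s j))) \<longlonglongrightarrow> 0"
            using LIMSEQ_subseq_LIMSEQ[OF LIMSEQ_Suc[OF lim_1_over_n] s(1)] by (simp add: o_def)
          \<comment> \<open>Stage \<open>s j\<close> controls increments of up to \<open>s j\<close>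
            factors, so a fixed k is covered once j \<ge> k.\<close>
          have "s j \<ge> j" for j using s(1) by (rule seq_suble)
          then show "eventually (\<lambda>j. (\<integral>h. (norm (avg f (X (s j) ** h) - avg f (X (s j))))\<^sup>2 \<partial>pw k)
              \<le> 1 / real (Suc (s j))) sequentially"
            unfolding eventually_sequentially avgX[OF f] avgX1[OF f]
            by (intro exI[of _ k] allI impI b(3)) (metis order_trans)
        qed (auto intro!: integral_nonneg_AE)
        ultimately have "(\<integral>h. (norm (avg f (A ** h) - avg f A))\<^sup>2 \<partial>pw k) = 0" by (rule LIMSEQ_unique)
        moreover have "integrable (pw k) (\<lambda>h. (norm (avg f (A ** h) - avg f A))\<^sup>2)"
          by (rule integrable_bounded_pw[of _ "2\<^sup>2"]) (use diff in simp_all)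
        ultimately have "AE h in pw k. (norm (avg f (A ** h) - avg f A))\<^sup>2 = 0"
          by (subst (asm) integral_nonneg_eq_0_iff_AE) auto
        then show ?thesis by simp
      qed
      show ?thesis
      proof (rule ccontr)
        assume neq: "avg f (A ** g) \<noteq> avg f A"
        \<comment> \<open>Almost sure equality extends to all of \<open>G\<close>: the exceptional
          set is open, and an open set meeting \<open>G\<close> is charged by some
          \<open>pw k\<close>.\<close>
        define V where "V = {h. invertible h \<and> avg f (A ** h) \<noteq> avg f A}"
        have opI: "open {h :: real^'n^'n. invertible h}"
          unfolding invertible_det_nz by (intro open_Collect_neq continuous_on_det_entries continuous_intros)
        have "continuous_on {h. invertible h} (\<lambda>h. avg f (A ** h))"
          unfolding continuous_on_sequentially o_def
          using mult_invertible_nonzero[OF A0] by (auto intro!: avg_tendsto[OF f] tendsto_mat_mat)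
        then have "open ({h. invertible h} \<inter> (\<lambda>h. avg f (A ** h)) -` (- {avg f A}))"
          by (rule continuous_open_preimage[OF _ opI]) auto
        also have "{h. invertible h} \<inter> (\<lambda>h. avg f (A ** h)) -` (- {avg f A}) = V" by (auto simp: V_def)
        finally have "open V" .
        then obtain k where "measure (pw k) V > 0"
          using G_charged[OF g, of V] neq G_inv[OF g] by (auto simp: V_def)
        moreover interpret prob_space "pw k" by (rule prob_pw)
        have "prob V = 0"
          using AEk[of k] \<open>open V\<close> by (subst prob_eq_0) (auto simp: V_def)
        ultimately show False by simp
      qed
    qed
    obtain z where z: "z \<noteq> 0" "\<And>v. A *v v \<in> span {z}"
      using rank_one_limit[OF prox A0] inv unfolding f_def by blast
    have "\<exists>x\<in>N. A *v x \<noteq> 0"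
    proof (rule ccontr)
      assume no: "\<not> ?thesis"
      have "A *v v = 0" if "v \<in> span N" for v
        using that by (rule linear_eq_0_on_span[rotated 2]) (use no in auto)
      then have "A *v v = 0 *v v" for v using N(2) by auto
      then show False using A0 by (metis matrix_eq)
    qed
    then obtain x where x: "x \<in> N" "A *v x \<noteq> 0" by blast
    have "(\<lambda>j. X (s j) *v x) \<longlonglongrightarrow> A *v x" by (rule tendsto_mat_vec[OF Xlim tendsto_const])
    moreover have "X (s j) *v x \<in> N" for j
    proof -
      have "X (s j) *v x = (1 / norm (b (s j))) *\<^sub>R (b (s j) *v x)"
        by (simp add: X_def scaleR_matrix_vector_assoc)
      then show ?thesis using b(1)[of "s j"] x(1) N(1) by (simp add: P_def closed_cone_def)
    qed
    ultimately have AxN: "A *v x \<in> N" using closed_sequentially[of N "\<lambda>j. X (s j) *v x"] clN by blast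
    obtain t where t: "A *v x = t *\<^sub>R z" using z(2)[of x] by (auto simp: span_singleton)
    then have "z \<in> N" using AxN x(2) closed_cone_scale_iff[OF N(1), of t z] by auto
    then have AN: "A *v v \<in> N" for v
      using z(2)[of v] N(1) by (auto simp: span_singleton closed_cone_def)
    have "AE v in \<rho>. q (A *v v) = 0"
      using AE_mat_vec_nonzero[OF A0] by eventually_elim (use AN cdist_eq_0_iff[OF N(1) ne] in \<open>simp add: q_def\<close>)
    then have "avg q A = 0" unfolding avg_def by (rule integral_eq_zero_AE)
    moreover have "(\<lambda>j. avg q (X (s j))) \<longlonglongrightarrow> avg q A" by (rule avg_tendsto[OF q(1) Xlim A0])
    then have "avg q A \<ge> avg q (mat 1) / 2"
      by (rule LIMSEQ_le_const) (use b(2) avgX1[OF q(1)] in auto)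
    ultimately show False using pos by simp
  qed
  moreover have "avg q (mat 1) \<ge> 0" unfolding avg_def by (intro integral_nonneg_AE AE_I2 q(3))
  ultimately have "(\<integral>v. q (mat 1 *v v) \<partial>\<rho>) = 0" by (simp add: avg_def)
  then have "AE v in \<rho>. q (mat 1 *v v) = 0"
    by (subst (asm) integral_nonneg_eq_0_iff_AE) (use integrable_hom0[OF q(1), of "mat 1"] q(3) in auto)
  then have "AE v in \<rho>. v \<in> N"
    using rho_nz by eventually_elim (use cdist_eq_0_iff[OF N(1) ne] in \<open>simp add: q_def\<close>)
  then show ?thesis using clN by (subst \<rho>.prob_eq_1) auto
qed

end

section \<open>Cones defined by polynomials\<close>

interpretation fv: vector_space "\<lambda>(c::real) (f::real^'n \<Rightarrow> real) v. c * f v"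
  by unfold_locales (auto simp: fun_eq_iff algebra_simps)

text \<open>Products of at most k coordinates, taken as functions: a finite set, so the polynomials
  of bounded degree have finite dimension.\<close>

primrec monomials :: "nat \<Rightarrow> (real^'n \<Rightarrow> real) set" where
  "monomials 0 = {\<lambda>v. 1}"
| "monomials (Suc k) = monomials k \<union> (\<lambda>(i, p) v. v $ i * p v) ` (UNIV \<times> monomials k)"

lemma finite_monomials: "finite (monomials k :: (real^'n \<Rightarrow> real) set)"
  by (induction k) auto

abbreviation polys :: "nat \<Rightarrow> (real^'n \<Rightarrow> real) set" where
  "polys k \<equiv> fv.span (monomials k)"

lemma polys_mono: "k \<le> l \<Longrightarrow> polys k \<subseteq> polys l"
  using lift_Suc_mono_le[of monomials k l] by (auto intro!: fv.span_mono)

lemma polys_coord_mult: "p \<in> polys k \<Longrightarrow> (\<lambda>v. v $ i * p v) \<in> polys (Suc k)"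
proof (induction p rule: fv.span_induct_alt)
  case base
  have "(\<lambda>v. v $ i * (0 :: real^'a \<Rightarrow> real) v) = 0" by (simp add: fun_eq_iff)
  then show ?case by (metis fv.span_zero)
next
  case (step c p q)
  have "(\<lambda>v. v $ i * p v) \<in> monomials (Suc k)" using step(1) by force
  then have "(\<lambda>v. c * (v $ i * p v)) + (\<lambda>v. v $ i * q v) \<in> polys (Suc k)"
    using step(2) by (intro fv.span_add fv.span_scale) (rule fv.span_base)
  moreover have "(\<lambda>v. c * (v $ i * p v)) + (\<lambda>v. v $ i * q v) = (\<lambda>v. v $ i * ((\<lambda>v. c * p v) + q) v)"
    by (simp add: fun_eq_iff algebra_simps)
  ultimately show ?case by simp
qed

lemma polys_mult_monomial: "p \<in> monomials k \<Longrightarrow> q \<in> polys l \<Longrightarrow> (\<lambda>v. p v * q v) \<in> polys (k + l)"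
proof (induction k arbitrary: p)
  case (Suc k)
  consider "p \<in> monomials k" | i p' where "p' \<in> monomials k" "p = (\<lambda>v. v $ i * p' v)" using Suc.prems by auto
  then show ?case
  proof cases
    case 1
    then show ?thesis using Suc polys_mono[of "k + l" "Suc k + l"] by auto
  next
    case 2
    from polys_coord_mult[OF Suc.IH[OF 2(1) Suc.prems(2)], of i]
    show ?thesis by (simp add: 2(2) mult.assoc)
  qed
qed auto

lemma polys_mult: "p \<in> polys k \<Longrightarrow> q \<in> polys l \<Longrightarrow> (\<lambda>v. p v * q v) \<in> polys (k + l)"
proof (induction p rule: fv.span_induct_alt)
  case base
  have "(\<lambda>v. (0 :: real^'a \<Rightarrow> real) v * q v) = 0" by (simp add: fun_eq_iff)
  then show ?case by (metis fv.span_zero)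
next
  case (step c p p')
  have "(\<lambda>v. c * (p v * q v)) + (\<lambda>v. p' v * q v) \<in> polys (k + l)"
    using step polys_mult_monomial by (intro fv.span_add fv.span_scale) auto
  moreover have "(\<lambda>v. c * (p v * q v)) + (\<lambda>v. p' v * q v) = (\<lambda>v. ((\<lambda>v. c * p v) + p') v * q v)"
    by (simp add: fun_eq_iff algebra_simps)
  ultimately show ?case by simp
qed

lemma polyfun_in_polys: "p \<in> polyfun \<Longrightarrow> \<exists>k. p \<in> polys k"
proof (induction rule: polyfun.induct)
  case (pf_const c)
  have "(\<lambda>v. c * (\<lambda>v. 1) v) \<in> polys 0" by (rule fv.span_scale) (simp add: fv.span_base)
  then show ?case by (intro exI[of _ 0]) simp
next
  case (pf_coord i)
  have "(\<lambda>v. v $ i) \<in> monomials (Suc 0)" by force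
  then show ?case using fv.span_base by blast
next
  case (pf_add p q)
  then obtain k l where "p \<in> polys k" "q \<in> polys l" by blast
  then have "p \<in> polys (max k l)" "q \<in> polys (max k l)"
    using polys_mono[of k "max k l"] polys_mono[of l "max k l"] by auto
  then have "p + q \<in> polys (max k l)" by (rule fv.span_add)
  then show ?case by (auto simp: plus_fun_def)
next
  case (pf_mult p q)
  then show ?case using polys_mult by blast
qed

text \<open>A linear substitution turns each coordinate into a combination of coordinates, so the
  degree does not grow. This is the invariance of the space of equations.\<close>

lemma polys_comp:
  fixes g :: "real^'n^'n"
  assumes "p \<in> polys k" shows "(\<lambda>v. p (g *v v)) \<in> polys k"
proof -
  have mono: "(\<lambda>v. p (g *v v)) \<in> polys k" if "p \<in> monomials k" for p :: "real^'n \<Rightarrow> real" and k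
    using that
  proof (induction k arbitrary: p)
    case 0
    then show ?case by (auto intro!: fv.span_base)
  next
    case (Suc k)
    consider "p \<in> monomials k" | i p' where "p' \<in> monomials k" "p = (\<lambda>v. v $ i * p' v)" using Suc.prems by auto
    then show ?case
    proof cases
      case 1
      then show ?thesis using Suc.IH polys_mono[of k "Suc k"] by auto
    next
      case 2
      have "(\<Sum>j\<in>UNIV. (\<lambda>v. g $ i $ j * (v $ j * p' (g *v v)))) \<in> polys (Suc k)"
        by (intro fv.span_sum fv.span_scale polys_coord_mult Suc.IH 2)
      moreover have "(\<Sum>j\<in>J. f j) v = (\<Sum>j\<in>J. f j v)" if "finite J" for J :: "'n set" and f and v :: "real^'n"
        using that by (induction J) auto
      then have "(\<Sum>j\<in>UNIV. (\<lambda>v. g $ i $ j * (v $ j * p' (g *v v)))) = (\<lambda>v. p (g *v v))"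
        by (auto simp: fun_eq_iff 2(2) matrix_vector_mult_def sum_distrib_right mult.assoc)
      ultimately show ?thesis by simp
    qed
  qed
  show ?thesis using assms
  proof (induction p rule: fv.span_induct_alt)
    case base
    have "(\<lambda>v. (0 :: real^'n \<Rightarrow> real) (g *v v)) = 0" by (simp add: fun_eq_iff)
    then show ?case by (metis fv.span_zero)
  next
    case (step c p q)
    have "(\<lambda>v. c * p (g *v v)) + (\<lambda>v. q (g *v v)) \<in> polys k"
      using step mono by (intro fv.span_add fv.span_scale) auto
    then show ?case by (simp add: plus_fun_def)
  qed
qed

lemma polys_continuous: "p \<in> polys k \<Longrightarrow> continuous_on UNIV p"
proof (induction p rule: fv.span_induct_alt)
  case (step c p q)
  have "continuous_on UNIV p" using step(1)
    by (induction k arbitrary: p) (auto intro!: continuous_intros)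
  then show ?case using step(2) by (auto simp: plus_fun_def intro!: continuous_intros)
qed (simp add: zero_fun_def)

text \<open>Imposing the equations on the whole line through v produces a cone even when the
  polynomials are not homogeneous, as may happen for the equations of a homogeneous set.\<close>

definition poly_cones :: "nat \<Rightarrow> (real^'n) set set" where
  "poly_cones k = {{v. \<forall>t. \<forall>p\<in>S. p (t *\<^sub>R v) = 0} | S. S \<subseteq> polys k}"

definition vanishing :: "nat \<Rightarrow> (real^'n) set \<Rightarrow> (real^'n \<Rightarrow> real) set" where
  "vanishing k A = {p \<in> polys k. \<forall>v\<in>A. p v = 0}"

lemma fv_dim_psubset:
  assumes "fv.subspace I" "fv.subspace J" "I \<subset> J" "J \<subseteq> fv.span T" "finite T"
  shows "fv.dim I < fv.dim J"
proof -
  obtain B where B: "B \<subseteq> I" "fv.independent B" "I \<subseteq> fv.span B" "card B = fv.dim I"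
    using fv.basis_exists by metis
  obtain C where C: "C \<subseteq> J" "fv.independent C" "J \<subseteq> fv.span C" "card C = fv.dim J"
    using fv.basis_exists by metis
  have fB: "finite B" using fv.independent_span_bound[OF assms(5) B(2)] B(1) assms(3,4) by blast
  have fC: "finite C" using fv.independent_span_bound[OF assms(5) C(2)] C(1) assms(4) by blast
  obtain x where x: "x \<in> J" "x \<notin> I" using assms(3) by blast
  have "x \<notin> fv.span B" using x(2) fv.span_minimal[OF B(1) assms(1)] by blast
  then have "fv.independent (insert x B)" by (rule fv.independent_insertI[OF _ B(2)])
  moreover have "insert x B \<subseteq> fv.span C" using x(1) B(1) C(3) assms(3) by blast
  ultimately have "card (insert x B) \<le> card C" using fv.independent_span_bound[OF fC] by blast
  moreover have "x \<notin> B" using x(2) B(1) by blast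
  ultimately show ?thesis using B(4) C(4) fB by simp
qed

lemma vanishing_subspace: "fv.subspace (vanishing k A)"
  unfolding fv.subspace_def vanishing_def
  by (auto simp: fv.span_zero fv.span_add fv.span_scale)

text \<open>The defining equations are among the vanishing ones (take t = 1). Since the cone is thus
  recovered from its equations, a strictly smaller cone satisfies strictly more of them.\<close>

lemma poly_cone_eq:
  assumes "A \<in> poly_cones k"
  shows "A = {v. \<forall>t. \<forall>p\<in>vanishing k A. p (t *\<^sub>R v) = 0}"
proof -
  obtain S where S: "S \<subseteq> polys k" "A = {v. \<forall>t. \<forall>p\<in>S. p (t *\<^sub>R v) = 0}"
    using assms by (auto simp: poly_cones_def)
  have "p v = 0" if "p \<in> S" "v \<in> A" for p v
    using that spec[of _ 1] unfolding S(2) by (metis (mono_tags, lifting) mem_Collect_eq scaleR_one)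
  then have "S \<subseteq> vanishing k A" using S(1) by (auto simp: vanishing_def)
  then have "{v. \<forall>t. \<forall>p\<in>vanishing k A. p (t *\<^sub>R v) = 0} \<subseteq> A" unfolding S(2) by blast
  moreover have "t *\<^sub>R v \<in> A" if "v \<in> A" for t v using that unfolding S(2) by simp
  then have "A \<subseteq> {v. \<forall>t. \<forall>p\<in>vanishing k A. p (t *\<^sub>R v) = 0}" by (auto simp: vanishing_def)
  ultimately show ?thesis by blast
qed

text \<open>Substituting g carries equations of \<open>A\<close> to equations of its preimage, and
  the inverse \<open>h\<close> undoes this, so a basis for the preimage transported by
  \<open>h\<close> spans the equations of \<open>A\<close>. Used for \<open>h\<close> too, the bound
  becomes an equality.\<close>

lemma dim_vanishing_vimage_le:
  fixes g :: "real^'n^'n"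
  assumes "invertible g"
  shows "fv.dim (vanishing k A) \<le> fv.dim (vanishing k ((\<lambda>v. g *v v) -` A))"
proof -
  obtain h where h: "g ** h = mat 1" "h ** g = mat 1" using assms by (auto simp: invertible_def)
  define J where "J = vanishing k ((\<lambda>v. g *v v) -` A)"
  obtain C where C: "C \<subseteq> J" "fv.independent C" "J \<subseteq> fv.span C" "card C = fv.dim J"
    using fv.basis_exists by metis
  have "J \<subseteq> polys k" by (auto simp: J_def vanishing_def)
  then have fC: "finite C" using fv.independent_span_bound[OF finite_monomials C(2)] C(1) by blast
  define T where "T p = (\<lambda>v. p (h *v v))" for p :: "real^'n \<Rightarrow> real"
  have T: "T p \<in> fv.span (T ` C)" if "p \<in> fv.span C" for p
    using that
  proof (induction p rule: fv.span_induct_alt)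
    case base
    have "T 0 = 0" by (simp add: T_def fun_eq_iff)
    then show ?case by (metis fv.span_zero)
  next
    case (step c p q)
    have "(\<lambda>v. c * T p v) + T q \<in> fv.span (T ` C)"
      using step by (intro fv.span_add fv.span_scale) (auto intro: fv.span_base)
    then show ?case by (simp add: T_def plus_fun_def)
  qed
  have "vanishing k A \<subseteq> fv.span (T ` C)"
  proof
    fix p assume p: "p \<in> vanishing k A"
    then have "(\<lambda>v. p (g *v v)) \<in> J" by (auto simp: J_def vanishing_def polys_comp)
    then have "T (\<lambda>v. p (g *v v)) \<in> fv.span (T ` C)" using C(3) T by blast
    then show "p \<in> fv.span (T ` C)" by (simp add: T_def matrix_vector_mul_assoc h)
  qed
  then have "fv.dim (vanishing k A) \<le> card (T ` C)" using fC by (intro fv.dim_le_card) auto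
  also have "\<dots> \<le> card C" using fC by (rule card_image_le)
  finally show ?thesis using C(4) by (simp add: J_def)
qed

text \<open>No truncation occurs: the dimension is at most the number of monomials.\<close>

definition poly_rank :: "nat \<Rightarrow> (real^'n) set \<Rightarrow> nat" where
  "poly_rank k A = card (monomials k :: (real^'n \<Rightarrow> real) set) - fv.dim (vanishing k A)"

lemma cone_family_poly: "cone_family (poly_cones k :: (real^'n) set set) (poly_rank k)"
proof
  fix A :: "(real^'n) set" assume A: "A \<in> poly_cones k"
  then obtain S where S: "S \<subseteq> polys k" "A = {v. \<forall>t. \<forall>p\<in>S. p (t *\<^sub>R v) = 0}"
    by (auto simp: poly_cones_def)
  have "A = (\<Inter>t. \<Inter>p\<in>S. (\<lambda>v. p (t *\<^sub>R v)) -` {0})" using S(2) by auto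
  moreover have "closed (\<Inter>t. \<Inter>p\<in>S. (\<lambda>v. p (t *\<^sub>R v)) -` {0})"
  proof (intro closed_INT ballI closed_vimage)
    fix t p assume "p \<in> S"
    then have "continuous_on UNIV p" using S(1) polys_continuous by blast
    then show "continuous_on UNIV (\<lambda>v. p (t *\<^sub>R v))"
      by (rule continuous_on_compose2) (auto intro!: continuous_intros)
  qed simp
  ultimately show "closed_cone A" using S(2) by (auto simp: closed_cone_def)
next
  have "UNIV = {v :: real^'n. \<forall>t. \<forall>p\<in>{}. p (t *\<^sub>R v) = (0::real)}" by simp
  then show "UNIV \<in> (poly_cones k :: (real^'n) set set)" unfolding poly_cones_def by blast
next
  fix A B :: "(real^'n) set" assume "A \<in> poly_cones k" "B \<in> poly_cones k"
  then obtain S T where S: "S \<subseteq> polys k" "A = {v. \<forall>t. \<forall>p\<in>S. p (t *\<^sub>R v) = 0}"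
    and T: "T \<subseteq> polys k" "B = {v. \<forall>t. \<forall>p\<in>T. p (t *\<^sub>R v) = 0}"
    by (auto simp: poly_cones_def)
  then have "A \<inter> B = {v. \<forall>t. \<forall>p\<in>S \<union> T. p (t *\<^sub>R v) = 0}" "S \<union> T \<subseteq> polys k" by auto
  then show "A \<inter> B \<in> poly_cones k" unfolding poly_cones_def by blast
next
  fix A :: "(real^'n) set" and g :: "real^'n^'n" assume A: "A \<in> poly_cones k" and g: "invertible g"
  then obtain S where S: "S \<subseteq> polys k" "A = {v. \<forall>t. \<forall>p\<in>S. p (t *\<^sub>R v) = 0}"
    by (auto simp: poly_cones_def)
  have "(\<lambda>v. g *v v) -` A = {v. \<forall>t. \<forall>p\<in>(\<lambda>p v. p (g *v v)) ` S. p (t *\<^sub>R v) = 0}"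
    using S(2) by (auto simp: matrix_vector_mult_scaleR)
  moreover have "(\<lambda>p v. p (g *v v)) ` S \<subseteq> polys k" using S(1) polys_comp by blast
  ultimately show "(\<lambda>v. g *v v) -` A \<in> poly_cones k" unfolding poly_cones_def by blast
  obtain h where h: "g ** h = mat 1" "h ** g = mat 1" using g by (auto simp: invertible_def)
  have "(\<lambda>v. h *v v) -` ((\<lambda>v. g *v v) -` A) = A" by (auto simp: matrix_vector_mul_assoc h)
  moreover have "invertible h" using h by (auto simp: invertible_def)
  ultimately have "fv.dim (vanishing k ((\<lambda>v. g *v v) -` A)) \<le> fv.dim (vanishing k A)"
    using dim_vanishing_vimage_le[of h k "(\<lambda>v. g *v v) -` A"] by simp
  then show "poly_rank k ((\<lambda>v. g *v v) -` A) = poly_rank k A"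
    using dim_vanishing_vimage_le[OF g, of k A] by (simp add: poly_rank_def)
next
  fix A B :: "(real^'n) set" assume A: "A \<in> poly_cones k" and B: "B \<in> poly_cones k" and AB: "A \<subset> B"
  have "vanishing k B \<subseteq> vanishing k A" using AB by (auto simp: vanishing_def)
  moreover have "vanishing k B \<noteq> vanishing k A"
    using AB poly_cone_eq[OF A] poly_cone_eq[OF B] by auto
  ultimately have "fv.dim (vanishing k B) < fv.dim (vanishing k A)"
    by (intro fv_dim_psubset[OF vanishing_subspace vanishing_subspace _ _ finite_monomials[of k]])
       (auto simp: vanishing_def)
  moreover have "fv.dim (vanishing k A) \<le> card (monomials k :: (real^'n \<Rightarrow> real) set)"
    by (rule fv.dim_le_card) (auto simp: vanishing_def finite_monomials)
  ultimately show "poly_rank k A < poly_rank k B" by (simp add: poly_rank_def)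
qed

section \<open>The zero-one law for a family of cones\<close>

context walk_family begin

text \<open>Preimage under g is injective and keeps \<open>Z\<close> in a finite set, so some power
  of g fixes \<open>Z\<close>. Its rescaled powers keep a vector \<open>w\<close> of
  \<open>Z\<close> inside \<open>Z\<close>; as \<open>Z\<close> spans, \<open>w\<close> can be
  chosen with \<open>R *v w\<close> nonzero, and this limit is a multiple of
  \<open>x\<close>.\<close>

lemma attracting_line_in_cone:
  assumes F: "finite F" "\<And>Z. Z \<in> F \<Longrightarrow> (\<lambda>v. g *v v) -` Z \<in> F" and Z: "Z \<in> F" "closed_cone Z" "span Z = UNIV"
    and g: "invertible g" and R: "c \<noteq> 0" "(\<lambda>j. (1 / c ^ j) *\<^sub>R matpow g j) \<longlonglongrightarrow> R" "R \<noteq> 0"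
      "\<And>v. R *v v \<in> span {x}"
  shows "x \<in> Z"
proof -
  define p where "p Z = (\<lambda>v. g *v v) -` Z" for Z
  have "surj (\<lambda>v. g *v v)"
    using g by (simp add: invertible_right_inverse matrix_right_invertible_surjective)
  then have "inj p" unfolding p_def by (intro injI) (metis surj_image_vimage_eq)
  moreover have pF: "(p ^^ n) Z \<in> F" for n
    by (induction n) (use F(2) Z(1) in \<open>auto simp: p_def\<close>)
  have "finite {Y. \<exists>n. Y = (p ^^ n) Z}" by (rule finite_subset[OF _ F(1)]) (use pF in auto)
  ultimately obtain n where n: "n > 0" "(p ^^ n) Z = Z" by (rule funpow_inj_finite) blast
  have pn: "(p ^^ n) Z = (\<lambda>v. matpow g n *v v) -` Z" for n
  proof (induction n)
    case (Suc n)
    have "matpow g (Suc n) = matpow g n ** g" using matpow_add[of g n 1] by simp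
    then show ?case using Suc by (simp add: p_def vimage_def matrix_vector_mul_assoc)
  qed simp
  have Zinv: "matpow (matpow g n) j *v v \<in> Z" if "v \<in> Z" for j v
  proof (induction j)
    case (Suc j)
    then have "matpow (matpow g n) j *v v \<in> (\<lambda>v. matpow g n *v v) -` Z" using n(2) pn[of n] by simp
    then show ?case by (simp add: matrix_vector_mul_assoc)
  qed (use that in simp)
  have "\<exists>w\<in>Z. R *v w \<noteq> 0"
  proof (rule ccontr)
    assume no: "\<not> ?thesis"
    have "R *v v = 0" if "v \<in> span Z" for v
      using that by (rule linear_eq_0_on_span[rotated 2]) (use no in auto)
    then have "R *v v = 0 *v v" for v using Z(3) by auto
    then show False using R(3) by (metis matrix_eq)
  qed
  then obtain w where w: "w \<in> Z" "R *v w \<noteq> 0" by blast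
  have "strict_mono (\<lambda>j. n * j)" using n(1) by (simp add: strict_mono_def)
  from LIMSEQ_subseq_LIMSEQ[OF R(2) this]
  have "(\<lambda>j. (1 / c ^ (n * j)) *\<^sub>R matpow g (n * j)) \<longlonglongrightarrow> R" by (simp add: o_def)
  from tendsto_mat_vec[OF this tendsto_const, of w]
  have lim: "(\<lambda>j. ((1 / c ^ (n * j)) *\<^sub>R matpow g (n * j)) *v w) \<longlonglongrightarrow> R *v w" .
  have "((1 / c ^ (n * j)) *\<^sub>R matpow g (n * j)) *v w \<in> Z" for j
    using Zinv[OF w(1), of j] Z(2)
    by (simp add: matpow_mult scaleR_matrix_vector_assoc[symmetric] closed_cone_def)
  then have "R *v w \<in> Z"
    using closed_sequentially[OF _ _ lim] Z(2) unfolding closed_cone_def by blast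
  moreover obtain t where t: "R *v w = t *\<^sub>R x" using R(4)[of w] by (auto simp: span_singleton)
  ultimately show ?thesis using w(2) closed_cone_scale_iff[OF Z(2), of t x] by auto
qed

lemma zero_one:
  assumes prox: "\<exists>g\<in>G. proximal g" and Y: "Y \<in> \<A>"
  shows "measure \<rho> Y = 0 \<or> measure \<rho> Y = 1"
proof -
  obtain F where F: "finite F" "F \<noteq> {}" "F \<subseteq> \<A>"
    and F_pos: "\<And>Z. Z \<in> F \<Longrightarrow> 0 < measure \<rho> Z"
    and F_min: "\<And>Z A. Z \<in> F \<Longrightarrow> A \<in> \<A> \<Longrightarrow> A \<subset> Z \<Longrightarrow> measure \<rho> A = 0"
    and F_span: "\<And>Z. Z \<in> F \<Longrightarrow> span Z = UNIV"
    and F_AE: "AE g in m. \<forall>Z\<in>F. (\<lambda>v. g *v v) -` Z \<in> F"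
    and F_G: "\<And>g Z. g \<in> G \<Longrightarrow> Z \<in> F \<Longrightarrow> (\<lambda>v. g *v v) -` Z \<in> F"
    by (rule minimal_cones) blast
  define N where "N = \<Inter>F"
  have N_cone: "closed_cone N"
    using F(3) cone unfolding N_def closed_cone_def by (auto intro!: closed_Inter)
  \<comment> \<open>The preimage of a member is itself a member and therefore contains
    \<open>N\<close>.\<close>
  have N_inv: "g *v v \<in> N" if "\<forall>Z\<in>F. (\<lambda>v. g *v v) -` Z \<in> F" "v \<in> N" for g v
    using that unfolding N_def by blast
  obtain g where g: "g \<in> G" "proximal g" using prox by blast
  obtain c :: real and R :: "real^'n^'n" and x :: "real^'n" where
    R: "c \<noteq> 0" "(\<lambda>j. (1 / c ^ j) *\<^sub>R matpow g j) \<longlonglongrightarrow> R" "R \<noteq> 0" "\<And>v. R *v v \<in> span {x}"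
    using proximal_powers_limit[OF g(2) G_inv[OF g(1)]] by blast
  have x0: "x \<noteq> 0"
  proof
    assume "x = 0"
    then have "R *v v = 0 *v v" for v using R(4)[of v] by simp
    then show False using R(3) by (metis matrix_eq)
  qed
  have xN: "x \<in> N"
    unfolding N_def
    by (intro InterI attracting_line_in_cone[OF F(1) F_G[OF g(1)] _ _ F_span G_inv[OF g(1)] R])
       (use F(3) cone in auto)
  have "span N = UNIV"
    by (rule span_invariant[OF N_inv xN x0]) (use F_G in auto)
  moreover have "AE g in m. \<forall>v\<in>N. g *v v \<in> N"
    using F_AE by eventually_elim (use N_inv in auto)
  ultimately have N1: "measure \<rho> N = 1" by (intro attracting_cone prox N_cone)
  obtain Z where Z: "Z \<in> F" using F(2) by blast
  have setsZ: "Z \<in> sets \<rho>" "Y \<in> sets \<rho>" "N \<in> sets \<rho>"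
    using cone Z F(3) Y N_cone by (auto simp: closed_cone_def)
  have "measure \<rho> N \<le> measure \<rho> Z"
    using Z setsZ by (intro \<rho>.finite_measure_mono) (auto simp: N_def)
  then have "measure \<rho> Z = 1" using N1 \<rho>.prob_le_1[of Z] by simp
  then have AEZ: "AE v in \<rho>. v \<in> Z" using setsZ by (simp add: \<rho>.prob_eq_1)
  have YZ: "measure \<rho> (Y \<inter> Z) = measure \<rho> Y"
    by (rule measure_eq_AE) (use AEZ setsZ in \<open>auto elim!: eventually_mono\<close>)
  show ?thesis
  proof (cases "Y \<inter> Z = Z")
    case True
    then show ?thesis using YZ \<open>measure \<rho> Z = 1\<close> by simp
  next
    case False
    then have "measure \<rho> (Y \<inter> Z) = 0" using Z F(3) Y by (intro F_min[OF Z] Int_in) auto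
    then show ?thesis using YZ by simp
  qed
qed

end

section \<open>Lifting from projective space\<close>

lemma openin_ptop: "openin ptop U \<longleftrightarrow> popen U"
  by (simp add: ptop_def topology_inverse'[OF istopology_popen])

lemma topspace_ptop: "topspace (ptop :: (real^'n) set topology) = Pspace"
proof -
  have "{v :: real^'n. v \<noteq> 0 \<and> pline v \<in> Pspace} = -{0}" by (auto simp: Pspace_def)
  then have "popen (Pspace :: (real^'n) set set)" by (simp add: popen_def open_Compl)
  then show ?thesis
    unfolding topspace_def openin_ptop by (auto simp: popen_def)
qed

lemma space_pborel: "space pborel = Pspace"
  by (simp add: pborel_def topspace_ptop space_measure_of_conv)

lemma openin_sets_pborel: "openin ptop U \<Longrightarrow> U \<in> sets pborel"
  by (auto simp: pborel_def intro!: in_measure_of dest: openin_subset)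

lemma pline_in_Pspace: "v \<noteq> 0 \<Longrightarrow> pline v \<in> Pspace"
  by (auto simp: Pspace_def)

lemma pline_eq_iff:
  assumes "v \<noteq> 0" "w \<noteq> 0"
  shows "pline v = pline w \<longleftrightarrow> w \<in> span {v}"
proof
  assume "w \<in> span {v}"
  then obtain t where t: "w = t *\<^sub>R v" by (auto simp: span_singleton)
  then have "v = (1/t) *\<^sub>R w" using assms(2) by auto
  then have "v \<in> span {w}" by (metis span_base span_scale singletonI)
  then show "pline v = pline w"
    unfolding pline_def using \<open>w \<in> span {v}\<close>
    by (intro subset_antisym span_minimal) auto
qed (metis pline_def span_base singletonI)

text \<open>An arbitrary choice, not claimed to be measurable. It enters measurability statements
  only through functions constant on lines.\<close>

definition rep :: "(real^'n) set \<Rightarrow> real^'n" where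
  "rep L = (SOME v. v \<noteq> 0 \<and> pline v = L)"

lemma rep: "L \<in> Pspace \<Longrightarrow> rep L \<noteq> 0 \<and> pline (rep L) = L"
  unfolding rep_def by (rule someI_ex) (auto simp: Pspace_def)

lemma rep_pline:
  assumes "v \<noteq> 0" obtains t where "t \<noteq> 0" "rep (pline v) = t *\<^sub>R v"
proof -
  have r: "rep (pline v) \<noteq> 0" "pline (rep (pline v)) = pline v"
    using rep[OF pline_in_Pspace[OF assms]] by auto
  then have "rep (pline v) \<in> span {v}" using pline_eq_iff[OF assms r(1)] by simp
  then show ?thesis using that r(1) by (auto simp: span_singleton)
qed

lemma hom0_rep_pline: "hom0 f \<Longrightarrow> v \<noteq> 0 \<Longrightarrow> f (rep (pline v)) = f v"
  by (metis rep_pline hom0_scale)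

lemma openin_ptop_hom0:
  fixes f :: "real^'n \<Rightarrow> 'b::euclidean_space"
  assumes f: "hom0 f" and U: "open U"
  shows "openin ptop {L \<in> Pspace. f (rep L) \<in> U}"
  unfolding openin_ptop popen_def
proof
  have "{v. v \<noteq> 0 \<and> pline v \<in> {L \<in> Pspace. f (rep L) \<in> U}} = -{0} \<inter> f -` U"
    using hom0_rep_pline[OF f] by (auto simp: pline_in_Pspace)
  also have "open \<dots>" by (rule continuous_open_preimage) (use f U in \<open>auto simp: hom0_def\<close>)
  finally show "open {v. v \<noteq> 0 \<and> pline v \<in> {L \<in> Pspace. f (rep L) \<in> U}}" .
qed auto

lemma continuous_map_hom0:
  fixes f :: "real^'n \<Rightarrow> real"
  assumes "hom0 f" shows "continuous_map ptop euclideanreal (\<lambda>L. f (rep L))"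
  unfolding continuous_map_def topspace_ptop using openin_ptop_hom0[OF assms] by simp

lemma measurable_hom0_rep:
  fixes f :: "real^'n \<Rightarrow> 'b::euclidean_space"
  assumes "hom0 f" shows "(\<lambda>L. f (rep L)) \<in> borel_measurable pborel"
proof (rule borel_measurableI)
  fix U :: "'b set" assume "open U"
  then have "{L \<in> Pspace. f (rep L) \<in> U} \<in> sets pborel"
    by (intro openin_sets_pborel openin_ptop_hom0 assms)
  moreover have "(\<lambda>L. f (rep L)) -` U \<inter> space pborel = {L \<in> Pspace. f (rep L) \<in> U}"
    by (auto simp: space_pborel)
  ultimately show "(\<lambda>L. f (rep L)) -` U \<inter> space pborel \<in> sets pborel" by simp
qed

text \<open>Row i of the projection onto the line of v is v scaled by v_i / (v . v): it depends
  measurably on the line alone and is nonzero when v_i is. Running through the coordinates finds a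
  nonzero row for every line.\<close>

lemma measurable_section:
  obtains s :: "(real^'n) set \<Rightarrow> real^'n" where "s \<in> borel_measurable pborel"
    "\<And>L. L \<in> Pspace \<Longrightarrow> s L \<noteq> 0 \<and> pline (s L) = L"
proof -
  have "\<exists>s \<in> borel_measurable pborel. \<forall>L\<in>Pspace. (\<exists>i\<in>I. rep L $ i \<noteq> 0) \<longrightarrow>
      s L \<noteq> (0 :: real^'n) \<and> s L \<in> span {rep L}" if "finite I" for I
    using that
  proof (induction I)
    case empty
    then show ?case by (intro bexI[of _ "\<lambda>_. 0"]) auto
  next
    case (insert i I)
    then obtain s where s: "s \<in> borel_measurable pborel"
      "\<forall>L\<in>Pspace. (\<exists>i\<in>I. rep L $ i \<noteq> 0) \<longrightarrow> s L \<noteq> (0 :: real^'n) \<and> s L \<in> span {rep L}" by blast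
    note [measurable] = s(1)
    have row: "line_proj v $ i = (v $ i / (v \<bullet> v)) *\<^sub>R v" for v :: "real^'n"
      by (simp add: line_proj_def vec_eq_iff)
    have "(\<lambda>x :: real^'n^'n. x $ i) \<in> borel_measurable borel"
      by (intro borel_measurable_continuous_onI continuous_intros)
    from measurable_compose[OF measurable_hom0_rep[OF hom0_line_proj] this]
    have [measurable]: "(\<lambda>L. line_proj (rep L) $ i) \<in> borel_measurable pborel" .
    define s' where "s' L = (if line_proj (rep L) $ i = 0 then s L else line_proj (rep L) $ i)" for L
    have "s' \<in> borel_measurable pborel" unfolding s'_def by measurable
    moreover have "s' L \<noteq> 0 \<and> s' L \<in> span {rep L}" if "L \<in> Pspace" "\<exists>j\<in>insert i I. rep L $ j \<noteq> 0" for L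
    proof (cases "rep L $ i = 0")
      case True
      then show ?thesis using that s(2) by (auto simp: s'_def row)
    next
      case False
      then show ?thesis using rep[OF that(1)] by (simp add: s'_def row span_scale span_base)
    qed
    ultimately show ?case by blast
  qed
  from this[of UNIV] obtain s where s: "s \<in> borel_measurable pborel"
    "\<forall>L\<in>Pspace. (\<exists>i. rep L $ i \<noteq> 0) \<longrightarrow> s L \<noteq> (0 :: real^'n) \<and> s L \<in> span {rep L}" by auto
  show ?thesis
  proof (rule that[OF s(1)])
    fix L :: "(real^'n) set" assume L: "L \<in> Pspace"
    then have "s L \<noteq> 0" "s L \<in> span {rep L}"
      using s(2) rep[OF L] by (auto simp: vec_eq_iff)
    then show "s L \<noteq> 0 \<and> pline (s L) = L" using rep[OF L] pline_eq_iff[of "rep L" "s L"] by simp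
  qed
qed

lemma pact_pline: "pact g (pline v) = pline (g *v v)"
proof -
  have "(\<lambda>v. g *v v) ` span {v} = span ((\<lambda>v. g *v v) ` {v})"
    by (metis linear_span_image matrix_vector_mul_linear)
  then show ?thesis by (simp add: pact_def pline_def)
qed

lemma Gamma_mu_invertible:
  assumes "g \<in> Gamma_mu \<mu>" shows "invertible g"
proof -
  have "msupport \<mu> \<subseteq> GL" by (auto simp: msupport_def)
  moreover have "a ** b \<in> GL" if "a \<in> GL" "b \<in> GL" for a b :: "real^'a^'a"
    using that by (simp add: GL_def invertible_mult)
  ultimately have "Gamma_mu \<mu> \<subseteq> GL" unfolding Gamma_mu_def by (intro Inter_lower) simp
  then show ?thesis using assms by (auto simp: GL_def)
qed

lemma Gamma_mu_mult: "a \<in> Gamma_mu \<mu> \<Longrightarrow> b \<in> Gamma_mu \<mu> \<Longrightarrow> a ** b \<in> Gamma_mu \<mu>"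
  unfolding Gamma_mu_def by blast

text \<open>Sequential closedness among invertible matrices gives
  \<open>S = GL \<inter> closure S\<close>, so \<open>S\<close> is one of the relatively closed
  semigroups being intersected.\<close>

lemma Gamma_mu_least:
  assumes inv: "\<And>g. g \<in> S \<Longrightarrow> invertible g"
    and closed: "\<And>X g. (\<And>j::nat. X j \<in> S) \<Longrightarrow> X \<longlonglongrightarrow> g \<Longrightarrow> invertible g \<Longrightarrow> g \<in> S"
    and mult: "\<And>a b. a \<in> S \<Longrightarrow> b \<in> S \<Longrightarrow> a ** b \<in> S"
    and supp: "msupport \<mu> \<subseteq> S"
  shows "Gamma_mu \<mu> \<subseteq> S"
proof -
  have "S \<subseteq> GL" using inv by (auto simp: GL_def)
  moreover have "S = GL \<inter> closure S"
  proof
    show "S \<subseteq> GL \<inter> closure S" using \<open>S \<subseteq> GL\<close> closure_subset by blast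
    show "GL \<inter> closure S \<subseteq> S"
    proof
      fix g assume g: "g \<in> GL \<inter> closure S"
      then obtain X where X: "\<forall>j. X j \<in> S" "X \<longlonglongrightarrow> g"
        by (auto simp: closure_sequential)
      show "g \<in> S" by (rule closed[OF _ X(2)]) (use X(1) g in \<open>simp_all add: GL_def\<close>)
    qed
  qed
  then have "closedin (top_of_set GL) S" by (metis closedin_closed_Int closed_closure)
  ultimately show ?thesis unfolding Gamma_mu_def using mult supp by blast
qed

theorem theorem2p2:
  fixes \<mu> :: "(real^'n^'n) measure" and \<nu> :: "(real^'n) set measure"
  assumes "CARD('n) \<ge> 2"
    and "prob_space \<mu>"
    and "sets \<mu> = sets (restrict_space borel GL)"
    and "strongly_irreducible (Gamma_mu \<mu>)"
    and "\<exists>g\<in>Gamma_mu \<mu>. proximal g"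
    and "stationary \<mu> \<nu>"
    and "palgebraic Y"
  shows "measure \<nu> Y = 0 \<or> measure \<nu> Y = 1"
proof -
  interpret mu: prob_space \<mu> by fact
  have nu: "prob_space \<nu>" "sets \<nu> = sets pborel" using assms(6) by (auto simp: stationary_def)
  interpret nu: prob_space \<nu> by fact
  have space_nu: "space \<nu> = Pspace" using sets_eq_imp_space_eq[OF nu(2)] by (simp add: space_pborel)
  have space_mu: "space \<mu> = GL" using sets_eq_imp_space_eq[OF assms(3)] by (simp add: space_restrict_space)
  obtain s :: "(real^'n) set \<Rightarrow> real^'n" where s: "s \<in> borel_measurable pborel"
    and s_line: "\<And>L. L \<in> Pspace \<Longrightarrow> s L \<noteq> 0 \<and> pline (s L) = L"
    by (rule measurable_section) blast
  have s_meas: "s \<in> \<nu> \<rightarrow>\<^sub>M borel" using s by (simp add: measurable_cong_sets[OF nu(2) refl])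
  have id_meas: "(\<lambda>g. g) \<in> \<mu> \<rightarrow>\<^sub>M borel"
    using measurable_restrict_space1[OF measurable_ident, of borel GL]
    by (simp add: measurable_cong_sets[OF assms(3) refl] id_def)
  \<comment> \<open>\<open>\<mu>\<close> is moved from \<open>GL\<close> to all matrices, and
    \<open>\<nu>\<close> from lines to measurably chosen vectors, so that both become Borel measures
    on Euclidean spaces.\<close>
  define m where "m = distr \<mu> borel (\<lambda>g. g)"
  define \<rho> where "\<rho> = distr \<nu> borel s"
  have m_meas: "measure m U = measure \<mu> (U \<inter> GL)" if "U \<in> sets borel" for U
    using that by (simp add: m_def measure_distr[OF id_meas] space_mu)
  obtain X where X: "algebraic_set X" "homogeneous_set X" "Y = {pline v | v. v \<in> X \<and> v \<noteq> 0}"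
    using assms(7) by (auto simp: palgebraic_def)
  obtain P where P: "finite P" "P \<subseteq> polyfun" "X = {v. \<forall>p\<in>P. p v = 0}"
    using X(1) by (auto simp: algebraic_set_def)
  \<comment> \<open>One degree bound serves all of the finitely many equations.\<close>
  obtain d where d: "P \<subseteq> polys d"
  proof -
    have "\<forall>p\<in>P. \<exists>k. p \<in> polys k" using P(2) polyfun_in_polys by blast
    then obtain k where k: "\<And>p. p \<in> P \<Longrightarrow> p \<in> polys (k p)" by metis
    have "P \<subseteq> polys (Max (k ` P))"
    proof
      fix p assume p: "p \<in> P"
      then have "k p \<le> Max (k ` P)" using P(1) by simp
      then show "p \<in> polys (Max (k ` P))" using k[OF p] polys_mono by blast
    qed
    then show ?thesis by (rule that)
  qed
  interpret cone_family "poly_cones d :: (real^'n) set set" "poly_rank d" by (rule cone_family_poly)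
  interpret matrix_walk m \<rho> "Gamma_mu \<mu>"
  proof (rule matrix_walk.intro)
    show "prob_space m" unfolding m_def by (rule mu.prob_space_distr[OF id_meas])
    show "sets m = sets borel" by (simp add: m_def)
    show "AE g in m. invertible g"
      unfolding m_def by (subst AE_distr_iff[OF id_meas]) (auto simp: sets_invertible space_mu GL_def intro!: AE_I2)
    show "prob_space \<rho>" unfolding \<rho>_def by (rule nu.prob_space_distr[OF s_meas])
    show "sets \<rho> = sets borel" by (simp add: \<rho>_def)
    show "AE v in \<rho>. v \<noteq> 0"
      unfolding \<rho>_def by (subst AE_distr_iff[OF s_meas]) (use s_line in \<open>auto simp: space_nu intro!: AE_I2\<close>)
    show "invertible g" if "g \<in> Gamma_mu \<mu>" for g using that by (rule Gamma_mu_invertible)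
    show "a ** b \<in> Gamma_mu \<mu>" if "a \<in> Gamma_mu \<mu>" "b \<in> Gamma_mu \<mu>" for a b
      using that by (rule Gamma_mu_mult)
    show "strongly_irreducible (Gamma_mu \<mu>)" by fact
    show "Gamma_mu \<mu> \<subseteq> S" if "\<And>g. g \<in> S \<Longrightarrow> invertible g"
      "\<And>X g. (\<And>j::nat. X j \<in> S) \<Longrightarrow> X \<longlonglongrightarrow> g \<Longrightarrow> invertible g \<Longrightarrow> g \<in> S"
      "\<And>a b. a \<in> S \<Longrightarrow> b \<in> S \<Longrightarrow> a ** b \<in> S"
      and supp: "\<And>g. invertible g \<Longrightarrow> (\<And>U. open U \<Longrightarrow> g \<in> U \<Longrightarrow> measure m U > 0) \<Longrightarrow> g \<in> S" for S
    proof (rule Gamma_mu_least)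
      show "msupport \<mu> \<subseteq> S"
        by (rule subsetI, rule supp) (auto simp: msupport_def GL_def m_meas[symmetric] m_meas)
    qed (use that in blast)+
    show "(\<integral>v. (\<integral>g. f (g *v v) \<partial>m) \<partial>\<rho>) = (\<integral>v. f v \<partial>\<rho>)" if f: "hom0 f" for f :: "real^'n \<Rightarrow> real"
    proof -
      note [measurable] = hom0_measurable[OF f]
      interpret m: prob_space m unfolding m_def by (rule mu.prob_space_distr[OF id_meas])
      have [measurable_cong]: "sets m = sets borel" by (simp add: m_def)
      have "(\<integral>v. (\<integral>g. f (g *v v) \<partial>m) \<partial>\<rho>) = (\<integral>L. (\<integral>g. f (g *v s L) \<partial>m) \<partial>\<nu>)"
        unfolding \<rho>_def
        by (rule integral_distr[OF s_meas]) (rule m.borel_measurable_lebesgue_integral, simp add: split_beta)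
      also have "\<dots> = (\<integral>L. (\<integral>g. f (g *v s L) \<partial>\<mu>) \<partial>\<nu>)"
        unfolding m_def by (subst integral_distr[OF id_meas]) simp_all
      \<comment> \<open>\<open>f\<close> is constant on lines, so \<open>g *v s L\<close> may be
        exchanged for the chosen representative of the image line; the integrand becomes a
        continuous function on projective space, to which stationarity applies.\<close>
      also have "\<dots> = (\<integral>L. (\<integral>g. f (rep (pact g L)) \<partial>\<mu>) \<partial>\<nu>)"
      proof (intro Bochner_Integration.integral_cong refl)
        fix L g assume "L \<in> space \<nu>" "g \<in> space \<mu>"
        then have L: "s L \<noteq> 0" "pline (s L) = L" and g: "invertible g"
          using s_line by (auto simp: space_nu space_mu GL_def)
        have "pact g L = pline (g *v s L)" using pact_pline[of g "s L"] L(2) by simp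
        then show "f (g *v s L) = f (rep (pact g L))"
          using hom0_rep_pline[OF f invertible_mult_nonzero[OF g L(1)]] by simp
      qed
      also have "\<dots> = (\<integral>L. f (rep L) \<partial>\<nu>)"
        using assms(6) continuous_map_hom0[OF f] by (auto simp: stationary_def)
      also have "\<dots> = (\<integral>L. f (s L) \<partial>\<nu>)"
        using s_line hom0_rep_pline[OF f]
        by (intro Bochner_Integration.integral_cong refl) (metis space_nu)
      also have "\<dots> = (\<integral>v. f v \<partial>\<rho>)"
        unfolding \<rho>_def by (rule integral_distr[OF s_meas, symmetric]) simp
      finally show ?thesis .
    qed
  qed
  interpret walk_family m \<rho> "Gamma_mu \<mu>" "poly_cones d" "poly_rank d" ..
  \<comment> \<open>By homogeneity the equations hold along the whole line through a point of
    \<open>X\<close>, which puts \<open>X\<close> into the family of cones.\<close>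
  have "X = {v. \<forall>t. \<forall>p\<in>P. p (t *\<^sub>R v) = 0}"
  proof -
    have "t *\<^sub>R v \<in> X" if "v \<in> X" for t v using X(2) that by (simp add: homogeneous_set_def)
    then have "X \<subseteq> {v. \<forall>t. \<forall>p\<in>P. p (t *\<^sub>R v) = 0}" unfolding P(3) by auto
    moreover have "{v. \<forall>t. \<forall>p\<in>P. p (t *\<^sub>R v) = 0} \<subseteq> X"
      unfolding P(3) by (auto dest!: spec[of _ 1])
    ultimately show ?thesis by blast
  qed
  then have Xin: "X \<in> poly_cones d" using d unfolding poly_cones_def by blast
  have "X \<in> sets borel" using cone[OF Xin] by (simp add: closed_cone_def)
  then have "measure \<rho> X = measure \<nu> (s -` X \<inter> space \<nu>)"
    unfolding \<rho>_def by (rule measure_distr[OF s_meas])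
  also have "s -` X \<inter> space \<nu> = Y"
  proof
    show "s -` X \<inter> space \<nu> \<subseteq> Y"
    proof
      fix L assume "L \<in> s -` X \<inter> space \<nu>"
      then have "s L \<in> X" "s L \<noteq> 0" "L = pline (s L)" using s_line[of L] by (auto simp: space_nu)
      then show "L \<in> Y" unfolding X(3) by blast
    qed
    show "Y \<subseteq> s -` X \<inter> space \<nu>"
    proof
      fix L assume "L \<in> Y"
      then obtain v where v: "v \<in> X" "v \<noteq> 0" "L = pline v" by (auto simp: X(3))
      have L: "L \<in> Pspace" using v pline_in_Pspace by blast
      then have "s L \<in> span {v}" using s_line[OF L] pline_eq_iff[OF v(2), of "s L"] v(3) by simp
      then have "s L \<in> X" using v(1) X(2) by (auto simp: span_singleton homogeneous_set_def)
      then show "L \<in> s -` X \<inter> space \<nu>" using L by (simp add: space_nu)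
    qed
  qed
  finally show ?thesis using zero_one[OF assms(5) Xin] by simp
qed

end
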